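(* Let $\mathbf P$ be a finite poset, $A=\Bbbk[\mathbf P]$, $M\in\operatorname{mod}A$, $I$ an interval of $\mathbf P$, and $i\ge0$ an integer. If $V_I$ is isomorphic to a direct summand of $M$, then $I\in\operatorname{crt}_i(M)$.
   Context: $\Bbbk$ is a field; $A=\Bbbk[\mathbf P]$ is the incidence category of $\mathbf P$ (the $\Bbbk$-linearization of $\mathbf P$ viewed as a category) and $\operatorname{mod}A$ is the category of $\Bbbk$-linear functors from $A$ to finite-dimensional $\Bbbk$-vector spaces. An interval of $\mathbf P$ is a nonempty connected convex full subposet $I$; $\mathbb I$ is the set of all intervals of $\mathbf P$. The interval module $V_I$ has $V_I(x)=\Bbbk$ for $x\in I$, $0$ otherwise, with identity structure maps inside $I$ and zero structure maps otherwise. For $N\in\operatorname{mod}A$: $\operatorname{supp}N=\{x\in\mathbf P\mid N(x)\ne0\}$, $\operatorname{top}N=N/\operatorname{rad}N$, $\operatorname{soc}N$ is the socle; $(P_j(N))_{j\ge0}$ are the terms of a minimal projective resolution of $N$, and $(Q^j(N))_{j\ge0}$ the terms of a minimal injective coresolution of $N$. The $i$-th critical set of intervals of $M$ is $$\operatorname{crt}_i(M)=\{I\in\mathbb I\mid\forall j\text{ with }0\le j\le i:\ \operatorname{supp}(\operatorname{top}P_j(V_I))\subseteq\operatorname{supp}(\operatorname{top}P_j(M)),\ \operatorname{supp}(\operatorname{soc}Q^j(V_I))\subseteq\operatorname{supp}(\operatorname{soc}Q^j(M))\}.$$ *)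

theory Defs
  imports Complex_Main "HOL-Library.Function_Algebras"
begin

section \<open>Finite-dimensional representations of a poset\<close>

text \<open>
  The poset is a type of sort \<open>{finite, order}\<close>. A \<open>k\<close>-linear functor from the incidence category
  \<open>k[P]\<close> (whose hom-spaces are \<open>k\<close> or \<open>0\<close>) is the same thing as a functor from \<open>P\<close> to vector
  spaces, and is given by the spaces \<open>spc M x\<close> and the structure maps \<open>act M x y\<close>, \<open>x \<le> y\<close>.
  The spaces of one representation are subspaces of a common ambient vector space
  \<open>('v, scal M)\<close>, which may be infinite-dimensional; \<open>act M x y\<close> is only relevant on \<open>spc M x\<close>.
\<close>

record ('p, 'k, 'v) rep =
  scal :: "'k \<Rightarrow> 'v \<Rightarrow> 'v"
  spc :: "'p \<Rightarrow> 'v set"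
  act :: "'p \<Rightarrow> 'p \<Rightarrow> 'v \<Rightarrow> 'v"

definition linear_between ::
  "('k \<Rightarrow> 'v::ab_group_add \<Rightarrow> 'v) \<Rightarrow> 'v set \<Rightarrow> ('k \<Rightarrow> 'w::ab_group_add \<Rightarrow> 'w) \<Rightarrow> 'w set \<Rightarrow> ('v \<Rightarrow> 'w) \<Rightarrow> bool"
  where "linear_between s V t W f \<longleftrightarrow>
    f ` V \<subseteq> W \<and>
    (\<forall>u\<in>V. \<forall>v\<in>V. f (u + v) = f u + f v) \<and>
    (\<forall>c. \<forall>v\<in>V. f (s c v) = t c (f v))"

definition is_mod :: "('p::{finite,order}, 'k::field, 'v::ab_group_add) rep \<Rightarrow> bool"
  where "is_mod M \<longleftrightarrow>
    vector_space (scal M) \<and>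
    (\<forall>x. \<exists>B. finite B \<and> spc M x = module.span (scal M) B) \<and>
    (\<forall>x y. x \<le> y \<longrightarrow> linear_between (scal M) (spc M x) (scal M) (spc M y) (act M x y)) \<and>
    (\<forall>x. \<forall>v\<in>spc M x. act M x x v = v) \<and>
    (\<forall>x y z. x \<le> y \<longrightarrow> y \<le> z \<longrightarrow> (\<forall>v\<in>spc M x. act M y z (act M x y v) = act M x z v))"

definition supp :: "('p::{finite,order}, 'k::field, 'v::ab_group_add) rep \<Rightarrow> 'p set"
  where "supp M = {x. spc M x \<noteq> {0}}"

definition is_hom ::
  "('p \<Rightarrow> 'v \<Rightarrow> 'w) \<Rightarrow> ('p::{finite,order}, 'k::field, 'v::ab_group_add) rep
    \<Rightarrow> ('p, 'k, 'w::ab_group_add) rep \<Rightarrow> bool"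
  where "is_hom f M N \<longleftrightarrow>
    (\<forall>x. linear_between (scal M) (spc M x) (scal N) (spc N x) (f x)) \<and>
    (\<forall>x y. x \<le> y \<longrightarrow> (\<forall>v\<in>spc M x. f y (act M x y v) = act N x y (f x v)))"

text \<open>Mono-, epi- and isomorphisms of functors are the pointwise ones.\<close>

definition is_mono ::
  "('p \<Rightarrow> 'v \<Rightarrow> 'w) \<Rightarrow> ('p::{finite,order}, 'k::field, 'v::ab_group_add) rep
    \<Rightarrow> ('p, 'k, 'w::ab_group_add) rep \<Rightarrow> bool"
  where "is_mono f M N \<longleftrightarrow> is_hom f M N \<and> (\<forall>x. inj_on (f x) (spc M x))"

definition is_epi ::
  "('p \<Rightarrow> 'v \<Rightarrow> 'w) \<Rightarrow> ('p::{finite,order}, 'k::field, 'v::ab_group_add) rep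
    \<Rightarrow> ('p, 'k, 'w::ab_group_add) rep \<Rightarrow> bool"
  where "is_epi f M N \<longleftrightarrow> is_hom f M N \<and> (\<forall>x. f x ` spc M x = spc N x)"

definition isomorphic ::
  "('p::{finite,order}, 'k::field, 'v::ab_group_add) rep \<Rightarrow> ('p, 'k, 'w::ab_group_add) rep \<Rightarrow> bool"
  where "isomorphic M N \<longleftrightarrow> (\<exists>f. is_mono f M N \<and> is_epi f M N)"


section \<open>Subobjects\<close>

text \<open>A subobject of \<open>M\<close> is given by its family of subspaces \<open>U\<close>; \<open>sub_of M U\<close> is the
  representation it carries.\<close>

definition is_sub :: "('p \<Rightarrow> 'v set) \<Rightarrow> ('p::{finite,order}, 'k::field, 'v::ab_group_add) rep \<Rightarrow> bool"
  where "is_sub U M \<longleftrightarrow>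
    (\<forall>x. module.subspace (scal M) (U x) \<and> U x \<subseteq> spc M x) \<and>
    (\<forall>x y. x \<le> y \<longrightarrow> act M x y ` U x \<subseteq> U y)"

definition sub_of :: "('p::{finite,order}, 'k::field, 'v::ab_group_add) rep \<Rightarrow> ('p \<Rightarrow> 'v set) \<Rightarrow> ('p, 'k, 'v) rep"
  where "sub_of M U = M\<lparr>spc := U\<rparr>"

definition ker_of ::
  "('p \<Rightarrow> 'v \<Rightarrow> 'w::ab_group_add) \<Rightarrow> ('p::{finite,order}, 'k::field, 'v::ab_group_add) rep \<Rightarrow> 'p \<Rightarrow> 'v set"
  where "ker_of f M = (\<lambda>x. {v \<in> spc M x. f x v = 0})"

definition im_of :: "('p \<Rightarrow> 'v \<Rightarrow> 'w) \<Rightarrow> ('p::{finite,order}, 'k::field, 'v::ab_group_add) rep \<Rightarrow> 'p \<Rightarrow> 'w set"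
  where "im_of f M = (\<lambda>x. f x ` spc M x)"

definition sub_sum :: "('p \<Rightarrow> 'v::ab_group_add set) \<Rightarrow> ('p \<Rightarrow> 'v set) \<Rightarrow> 'p \<Rightarrow> 'v set"
  where "sub_sum U W = (\<lambda>x. {u + w |u w. u \<in> U x \<and> w \<in> W x})"

definition sub_Int :: "('p \<Rightarrow> 'v set) \<Rightarrow> ('p \<Rightarrow> 'v set) \<Rightarrow> 'p \<Rightarrow> 'v set"
  where "sub_Int U W = (\<lambda>x. U x \<inter> W x)"

definition sub_zero :: "'p \<Rightarrow> 'v::ab_group_add set"
  where "sub_zero = (\<lambda>x. {0})"

definition direct_summand :: "('p \<Rightarrow> 'v set) \<Rightarrow> ('p::{finite,order}, 'k::field, 'v::ab_group_add) rep \<Rightarrow> bool"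
  where "direct_summand U M \<longleftrightarrow>
    is_sub U M \<and> (\<exists>W. is_sub W M \<and> sub_sum U W = spc M \<and> sub_Int U W = sub_zero)"

definition superfluous :: "('p \<Rightarrow> 'v set) \<Rightarrow> ('p::{finite,order}, 'k::field, 'v::ab_group_add) rep \<Rightarrow> bool"
  where "superfluous U M \<longleftrightarrow>
    is_sub U M \<and> (\<forall>W. is_sub W M \<longrightarrow> sub_sum U W = spc M \<longrightarrow> W = spc M)"

definition essential :: "('p \<Rightarrow> 'v set) \<Rightarrow> ('p::{finite,order}, 'k::field, 'v::ab_group_add) rep \<Rightarrow> bool"
  where "essential U M \<longleftrightarrow>
    is_sub U M \<and> (\<forall>W. is_sub W M \<longrightarrow> sub_Int U W = sub_zero \<longrightarrow> W = sub_zero)"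


section \<open>Radical, top and socle\<close>

definition maximal_sub :: "('p \<Rightarrow> 'v set) \<Rightarrow> ('p::{finite,order}, 'k::field, 'v::ab_group_add) rep \<Rightarrow> bool"
  where "maximal_sub U M \<longleftrightarrow>
    is_sub U M \<and> U \<noteq> spc M \<and>
    (\<forall>W. is_sub W M \<longrightarrow> (\<forall>x. U x \<subseteq> W x) \<longrightarrow> W = U \<or> W = spc M)"

definition simple_sub :: "('p \<Rightarrow> 'v set) \<Rightarrow> ('p::{finite,order}, 'k::field, 'v::ab_group_add) rep \<Rightarrow> bool"
  where "simple_sub U M \<longleftrightarrow>
    is_sub U M \<and> U \<noteq> sub_zero \<and>
    (\<forall>W. is_sub W M \<longrightarrow> (\<forall>x. W x \<subseteq> U x) \<longrightarrow> W = sub_zero \<or> W = U)"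

definition rad :: "('p::{finite,order}, 'k::field, 'v::ab_group_add) rep \<Rightarrow> 'p \<Rightarrow> 'v set"
  where "rad M = (\<lambda>x. {v \<in> spc M x. \<forall>U. maximal_sub U M \<longrightarrow> v \<in> U x})"

text \<open>\<open>top_spc M x\<close> is the underlying set of the quotient space \<open>spc M x / rad M x\<close>, a set of
  cosets with zero element \<open>rad M x\<close>.\<close>

definition top_spc :: "('p::{finite,order}, 'k::field, 'v::ab_group_add) rep \<Rightarrow> 'p \<Rightarrow> 'v set set"
  where "top_spc M x = (\<lambda>v. (\<lambda>r. v + r) ` rad M x) ` spc M x"

definition supp_top :: "('p::{finite,order}, 'k::field, 'v::ab_group_add) rep \<Rightarrow> 'p set"
  where "supp_top M = {x. top_spc M x \<noteq> {rad M x}}"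

definition soc :: "('p::{finite,order}, 'k::field, 'v::ab_group_add) rep \<Rightarrow> ('p, 'k, 'v) rep"
  where "soc M = sub_of M (\<lambda>x. module.span (scal M) (\<Union>U\<in>{U. simple_sub U M}. U x))"


section \<open>Projectives, injectives and minimal resolutions\<close>

text \<open>
  Every object of \<open>mod k[P]\<close> is isomorphic to one with ambient space \<open>nat \<Rightarrow> 'k\<close>, which contains
  copies of all finite-dimensional spaces. Hence projectivity and injectivity may be tested on,
  and the terms of resolutions taken from, this universe.
\<close>

type_synonym ('p, 'k) urep = "('p, 'k, nat \<Rightarrow> 'k) rep"

definition projective :: "('p::{finite,order}, 'k::field) urep \<Rightarrow> bool"
  where "projective P \<longleftrightarrow> is_mod P \<and>
    (\<forall>(X :: ('p, 'k) urep) (Y :: ('p, 'k) urep) g h.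
       is_mod X \<longrightarrow> is_mod Y \<longrightarrow> is_epi g X Y \<longrightarrow> is_hom h P Y \<longrightarrow>
       (\<exists>l. is_hom l P X \<and> (\<forall>x. \<forall>v\<in>spc P x. g x (l x v) = h x v)))"

definition injective :: "('p::{finite,order}, 'k::field) urep \<Rightarrow> bool"
  where "injective Q \<longleftrightarrow> is_mod Q \<and>
    (\<forall>(X :: ('p, 'k) urep) (Y :: ('p, 'k) urep) g h.
       is_mod X \<longrightarrow> is_mod Y \<longrightarrow> is_mono g X Y \<longrightarrow> is_hom h X Q \<longrightarrow>
       (\<exists>l. is_hom l Y Q \<and> (\<forall>x. \<forall>v\<in>spc X x. l x (g x v) = h x v)))"

definition projective_cover ::
  "('p \<Rightarrow> (nat \<Rightarrow> 'k) \<Rightarrow> 'v) \<Rightarrow> ('p::{finite,order}, 'k::field) urep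
    \<Rightarrow> ('p, 'k, 'v::ab_group_add) rep \<Rightarrow> bool"
  where "projective_cover f P N \<longleftrightarrow> projective P \<and> is_epi f P N \<and> superfluous (ker_of f P) P"

definition injective_envelope ::
  "('p \<Rightarrow> 'v \<Rightarrow> (nat \<Rightarrow> 'k)) \<Rightarrow> ('p::{finite,order}, 'k::field, 'v::ab_group_add) rep
    \<Rightarrow> ('p, 'k) urep \<Rightarrow> bool"
  where "injective_envelope f N Q \<longleftrightarrow> injective Q \<and> is_mono f N Q \<and> essential (im_of f N) Q"

text \<open>\<open>\<dots> \<rightarrow> P 1 \<rightarrow> P 0 \<rightarrow> N \<rightarrow> 0\<close> with differentials \<open>d j : P (j+1) \<rightarrow> P j\<close> and augmentation \<open>e\<close>.\<close>

definition projective_resolution ::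
  "('p::{finite,order}, 'k::field, 'v::ab_group_add) rep \<Rightarrow> (nat \<Rightarrow> ('p, 'k) urep)
    \<Rightarrow> (nat \<Rightarrow> 'p \<Rightarrow> (nat \<Rightarrow> 'k) \<Rightarrow> (nat \<Rightarrow> 'k)) \<Rightarrow> ('p \<Rightarrow> (nat \<Rightarrow> 'k) \<Rightarrow> 'v) \<Rightarrow> bool"
  where "projective_resolution N P d e \<longleftrightarrow>
    (\<forall>j. projective (P j)) \<and>
    (\<forall>j. is_hom (d j) (P (Suc j)) (P j)) \<and>
    is_epi e (P 0) N \<and>
    im_of (d 0) (P 1) = ker_of e (P 0) \<and>
    (\<forall>j. im_of (d (Suc j)) (P (Suc (Suc j))) = ker_of (d j) (P (Suc j)))"

definition minimal_projective_resolution ::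
  "('p::{finite,order}, 'k::field, 'v::ab_group_add) rep \<Rightarrow> (nat \<Rightarrow> ('p, 'k) urep)
    \<Rightarrow> (nat \<Rightarrow> 'p \<Rightarrow> (nat \<Rightarrow> 'k) \<Rightarrow> (nat \<Rightarrow> 'k)) \<Rightarrow> ('p \<Rightarrow> (nat \<Rightarrow> 'k) \<Rightarrow> 'v) \<Rightarrow> bool"
  where "minimal_projective_resolution N P d e \<longleftrightarrow>
    projective_resolution N P d e \<and>
    projective_cover e (P 0) N \<and>
    (\<forall>j. projective_cover (d j) (P (Suc j)) (sub_of (P j) (im_of (d j) (P (Suc j)))))"

text \<open>\<open>0 \<rightarrow> N \<rightarrow> Q 0 \<rightarrow> Q 1 \<rightarrow> \<dots>\<close> with differentials \<open>d j : Q j \<rightarrow> Q (j+1)\<close> and coaugmentation \<open>e\<close>.\<close>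

definition injective_coresolution ::
  "('p::{finite,order}, 'k::field, 'v::ab_group_add) rep \<Rightarrow> (nat \<Rightarrow> ('p, 'k) urep)
    \<Rightarrow> (nat \<Rightarrow> 'p \<Rightarrow> (nat \<Rightarrow> 'k) \<Rightarrow> (nat \<Rightarrow> 'k)) \<Rightarrow> ('p \<Rightarrow> 'v \<Rightarrow> (nat \<Rightarrow> 'k)) \<Rightarrow> bool"
  where "injective_coresolution N Q d e \<longleftrightarrow>
    (\<forall>j. injective (Q j)) \<and>
    (\<forall>j. is_hom (d j) (Q j) (Q (Suc j))) \<and>
    is_mono e N (Q 0) \<and>
    im_of e N = ker_of (d 0) (Q 0) \<and>
    (\<forall>j. im_of (d j) (Q j) = ker_of (d (Suc j)) (Q (Suc j)))"

definition minimal_injective_coresolution ::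
  "('p::{finite,order}, 'k::field, 'v::ab_group_add) rep \<Rightarrow> (nat \<Rightarrow> ('p, 'k) urep)
    \<Rightarrow> (nat \<Rightarrow> 'p \<Rightarrow> (nat \<Rightarrow> 'k) \<Rightarrow> (nat \<Rightarrow> 'k)) \<Rightarrow> ('p \<Rightarrow> 'v \<Rightarrow> (nat \<Rightarrow> 'k)) \<Rightarrow> bool"
  where "minimal_injective_coresolution N Q d e \<longleftrightarrow>
    injective_coresolution N Q d e \<and>
    injective_envelope e N (Q 0) \<and>
    (\<forall>j. injective_envelope (\<lambda>x v. v) (sub_of (Q (Suc j)) (im_of (d j) (Q j))) (Q (Suc j)))"

text \<open>Minimal resolutions exist and are unique up to isomorphism, so their terms are those of an
  arbitrarily chosen one.\<close>

definition proj_term :: "nat \<Rightarrow> ('p::{finite,order}, 'k::field, 'v::ab_group_add) rep \<Rightarrow> ('p, 'k) urep"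
  where "proj_term j N = (SOME P. \<exists>d e. minimal_projective_resolution N P d e) j"

definition inj_term :: "nat \<Rightarrow> ('p::{finite,order}, 'k::field, 'v::ab_group_add) rep \<Rightarrow> ('p, 'k) urep"
  where "inj_term j N = (SOME Q. \<exists>d e. minimal_injective_coresolution N Q d e) j"


section \<open>Intervals, interval modules and critical sets\<close>

definition convex_in :: "'p::order set \<Rightarrow> bool"
  where "convex_in I \<longleftrightarrow> (\<forall>x\<in>I. \<forall>z\<in>I. \<forall>y. x \<le> y \<longrightarrow> y \<le> z \<longrightarrow> y \<in> I)"

definition connected_in :: "'p::order set \<Rightarrow> bool"
  where "connected_in I \<longleftrightarrow>
    (\<forall>x\<in>I. \<forall>y\<in>I. (x, y) \<in> {(a, b). a \<in> I \<and> b \<in> I \<and> (a \<le> b \<or> b \<le> a)}\<^sup>*)"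

definition interval :: "'p::order set \<Rightarrow> bool"
  where "interval I \<longleftrightarrow> I \<noteq> {} \<and> connected_in I \<and> convex_in I"

definition interval_module :: "'p::{finite,order} set \<Rightarrow> ('p, 'k::field, 'k) rep"
  where "interval_module I =
    \<lparr>scal = (*),
     spc = (\<lambda>x. if x \<in> I then UNIV else {0}),
     act = (\<lambda>x y v. if x \<in> I \<and> y \<in> I then v else 0)\<rparr>"

definition crt :: "nat \<Rightarrow> ('p::{finite,order}, 'k::field, 'v::ab_group_add) rep \<Rightarrow> 'p set set"
  where "crt i M = {I. interval I \<and> (\<forall>j\<le>i.
    supp_top (proj_term j (interval_module I :: ('p, 'k, 'k) rep)) \<subseteq> supp_top (proj_term j M) \<and>
    supp (soc (inj_term j (interval_module I :: ('p, 'k, 'k) rep))) \<subseteq> supp (soc (inj_term j M)))}"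

end

theory Submission
  imports Defs
begin

text \<open>
  If \<open>a : N \<rightarrow> M\<close> and \<open>b : M \<rightarrow> N\<close> have an epimorphic
  composite \<open>b a\<close>, then so does the lifted pair \<open>a\<^sub>0, b\<^sub>0\<close>, because the kernel of the cover
  is superfluous; by finite dimension \<open>b\<^sub>0 a\<^sub>0\<close> is then bijective, hence injective and so
  bijective on that kernel, and the argument iterates along minimal resolutions. This gives epimorphisms
  \<open>P\<^sub>j(M) \<rightarrow> P\<^sub>j(N)\<close>, and epimorphisms map radicals into radicals. Dually one gets
  monomorphisms \<open>Q\<^sup>j(N) \<rightarrow> Q\<^sup>j(M)\<close>, which map simple subobjects to simple ones.
  Since the terms of minimal resolutions are chosen by Hilbert choice, these resolutions also have to be
  constructed.
\<close>

section \<open>Linear algebra\<close>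

text \<open>The relation carried along the resolutions asks only that \<open>b a\<close> be
  epimorphic because a lift of the identity to a minimal cover is an automorphism but need not be
  the identity, so the equation \<open>b a = 1\<close> need not hold for the given lifts. The two
  sides also differ: a syzygy is a subobject, to which lifts restrict, whereas a cosyzygy is a
  quotient, which would require a new ambient space. The cosyzygy is therefore realised as the image
  of the differential inside the next injective, and bases of quotients are replaced by bases of
  complements with their coordinate functionals. The explicit covers and envelopes rest on the
  Yoneda description of maps out of sums of indecomposable projectives and into sums of
  indecomposable injectives: such a map is an arbitrary choice of one vector, respectively one
  functional, for each generator.\<close>

lemma linear_between_zero:
  assumes "vector_space s" "vector_space t" "module.subspace s V" "linear_between s V t W f"
  shows "f 0 = 0"
proof -
  interpret V: vector_space s by fact
  interpret W: vector_space t by fact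
  have "f (s 0 0) = t 0 (f 0)"
    using assms(4) V.subspace_0[OF assms(3)] unfolding linear_between_def by blast
  then show ?thesis by simp
qed

text \<open>Components of representations are meaningful only on a subspace, whereas results on
  \<open>Vector_Spaces.linear\<close> concern total maps; this is the bridge. \<open>g\<close> is
  prescribed on a basis of \<open>V\<close>, and the set where it agrees with \<open>f\<close> is a
  subspace containing that basis.\<close>

lemma linear_between_extend:
  fixes s :: "'k::field \<Rightarrow> 'v::ab_group_add \<Rightarrow> 'v" and t :: "'k \<Rightarrow> 'w::ab_group_add \<Rightarrow> 'w"
  assumes s: "vector_space s" and t: "vector_space t" and V: "module.subspace s V"
    and f: "linear_between s V t W f"
  obtains g where "Vector_Spaces.linear s t g" "\<And>v. v \<in> V \<Longrightarrow> g v = f v"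
proof -
  interpret s: vector_space s by fact
  interpret t: vector_space t by fact
  interpret p: vector_space_pair s t ..
  obtain B where B: "B \<subseteq> V" "s.independent B" "V \<subseteq> s.span B"
    using s.maximal_independent_subset by blast
  define g where "g = p.construct B f"
  have g: "Vector_Spaces.linear s t g"
    unfolding g_def by (rule p.linear_construct[OF B(2)])
  interpret g: Vector_Spaces.linear s t g by fact
  have "s.subspace {v \<in> V. g v = f v}"
    using s.subspace_0[OF V] s.subspace_add[OF V] s.subspace_scale[OF V] f
      linear_between_zero[OF s t V f]
    by (auto simp: s.subspace_def g.add g.scale g.zero linear_between_def)
  moreover have "B \<subseteq> {v \<in> V. g v = f v}"
    using B(1) p.construct_basis[OF B(2)] by (auto simp: g_def)
  ultimately have "s.span B \<subseteq> {v \<in> V. g v = f v}"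
    by (rule s.span_minimal[rotated])
  with B(3) g show thesis by (intro that[of g]) auto
qed

text \<open>Independent subsets of a finitely spanned space are finite, so a maximal one in
  \<open>V\<close> is a finite basis.\<close>

lemma subspace_finite_span:
  assumes s: "vector_space s" and "finite B" "V \<subseteq> module.span s B" "module.subspace s V"
  obtains C where "finite C" "\<not> module.dependent s C" "V = module.span s C"
proof -
  interpret s: vector_space s by fact
  obtain C where C: "C \<subseteq> V" "s.independent C" "V \<subseteq> s.span C"
    using s.maximal_independent_subset by blast
  have "finite C"
    using s.independent_span_bound[OF assms(2) C(2)] C(1) assms(3) by blast
  moreover have "V = s.span C"
    using C s.span_minimal[OF C(1) assms(4)] by blast
  ultimately show thesis using C(2) that by blast
qed

text \<open>The image of a basis \<open>C\<close> is independent and has as many elements as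
  \<open>C\<close>; a vector of \<open>V\<close> outside its span would yield an independent set
  with one element more inside \<open>span C\<close>.\<close>

lemma inj_endo_imp_surj:
  fixes s :: "'k::field \<Rightarrow> 'v::ab_group_add \<Rightarrow> 'v"
  assumes s: "vector_space s" and "finite B" and V: "V = module.span s B"
    and f: "linear_between s V s V f" and inj: "inj_on f V"
  shows "f ` V = V"
proof -
  interpret s: vector_space s by fact
  have sub: "s.subspace V" unfolding V by simp
  obtain C where C: "finite C" "s.independent C" "V = s.span C"
    using subspace_finite_span[OF s assms(2) _ sub] V by blast
  obtain g where g: "Vector_Spaces.linear s s g" "\<And>v. v \<in> V \<Longrightarrow> g v = f v"
    using linear_between_extend[OF s s sub f] by blast
  interpret g: Vector_Spaces.linear s s g by fact
  have injg: "inj_on g (s.span C)"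
    using inj g(2) C(3) by (simp add: inj_on_def)
  have "C \<subseteq> V" using C(3) s.span_superset by blast
  then have "inj_on g C" using injg C(3) inj_on_subset by blast
  have ind: "s.independent (g ` C)"
    by (rule g.independent_injective_image[OF C(2) injg])
  have fV: "f ` V \<subseteq> V" using f by (simp add: linear_between_def)
  have gC: "g ` C \<subseteq> V" using fV g(2) \<open>C \<subseteq> V\<close> by (metis (no_types, lifting) image_subset_iff subset_iff)
  have "V \<subseteq> s.span (g ` C)"
  proof (rule ccontr)
    assume "\<not> ?thesis"
    then obtain v where v: "v \<in> V" "v \<notin> s.span (g ` C)" by blast
    have "s.independent (insert v (g ` C))" by (rule s.independent_insertI[OF v(2) ind])
    then have "card (insert v (g ` C)) \<le> card C"
      using s.independent_span_bound[OF C(1)] v(1) gC C(3) by blast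
    moreover have "v \<notin> g ` C" using v(2) s.span_base by blast
    ultimately show False using C(1) card_image[OF \<open>inj_on g C\<close>] by simp
  qed
  also have "s.span (g ` C) = g ` s.span C" by (simp add: g.span_image)
  also have "\<dots> = f ` V" using g(2) C(3) by (metis image_cong)
  finally show ?thesis using fV by blast
qed

text \<open>A linear right inverse \<open>h\<close> with values in \<open>V\<close> is injective on
  \<open>V\<close>, hence onto \<open>V\<close> by the previous lemma; so every vector of
  \<open>V\<close> has the form \<open>h v\<close> and is determined by
  \<open>f (h v) = v\<close>.\<close>

lemma surj_endo_imp_inj:
  fixes s :: "'k::field \<Rightarrow> 'v::ab_group_add \<Rightarrow> 'v"
  assumes s: "vector_space s" and "finite B" and V: "V = module.span s B"
    and f: "linear_between s V s V f" and surj: "f ` V = V"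
  shows "inj_on f V"
proof -
  interpret s: vector_space s by fact
  interpret p: vector_space_pair s s ..
  have sub: "s.subspace V" unfolding V by simp
  obtain g where g: "Vector_Spaces.linear s s g" "\<And>v. v \<in> V \<Longrightarrow> g v = f v"
    using linear_between_extend[OF s s sub f] by blast
  obtain h where h: "range h \<subseteq> V" "Vector_Spaces.linear s s h" "\<And>v. v \<in> g ` V \<Longrightarrow> g (h v) = v"
    using p.linear_exists_right_inverse_on[OF g(1) sub] by blast
  interpret h: Vector_Spaces.linear s s h by fact
  have gV: "g ` V = V" using surj g(2) by (metis image_cong)
  have fh: "f (h v) = v" if "v \<in> V" for v
    using h(3)[of v] h(1) g(2) gV that by (metis rangeI subsetD)
  have "linear_between s V s V h"
    using h(1) by (auto simp: linear_between_def h.add h.scale)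
  moreover have "inj_on h V" using fh by (metis inj_onI)
  ultimately have "h ` V = V" using inj_endo_imp_surj[OF s assms(2) V] by blast
  then show ?thesis using fh by (metis (no_types, lifting) image_iff inj_onI)
qed

text \<open>For a subspace \<open>U\<close> of \<open>S\<close>, \<open>T\<close> is a basis of a
  complement and \<open>\<phi>\<close> its system of coordinates: a substitute for a basis of
  \<open>S / U\<close> with its dual basis that avoids quotient spaces. The functionals are linear
  on the whole ambient space, so they can be evaluated without membership conditions.\<close>

definition relative_dual_basis ::
  "('k::field \<Rightarrow> 'v::ab_group_add \<Rightarrow> 'v) \<Rightarrow> 'v set \<Rightarrow> 'v set \<Rightarrow> 'v set \<Rightarrow> ('v \<Rightarrow> 'v \<Rightarrow> 'k) \<Rightarrow> bool"
  where "relative_dual_basis s U S T \<phi> \<longleftrightarrow> finite T \<and> T \<subseteq> S \<and>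
    (\<forall>t\<in>T. linear_between s UNIV (*) UNIV (\<phi> t)) \<and>
    (\<forall>t\<in>T. \<forall>t'\<in>T. \<phi> t t' = (if t = t' then 1 else 0)) \<and>
    (\<forall>t\<in>T. \<forall>u\<in>U. \<phi> t u = 0) \<and>
    (\<forall>v\<in>S. v - (\<Sum>t\<in>T. s (\<phi> t v) t) \<in> U)"

text \<open>A basis \<open>C\<close> of \<open>U\<close> is extended to a basis \<open>D\<close> of
  \<open>S\<close> and further to a basis \<open>E\<close> of the ambient space; \<open>T\<close> is
  \<open>D - C\<close>, and \<open>\<phi>\<close> reads off coordinates with respect to
  \<open>E\<close>. Vectors of \<open>U\<close> involve only \<open>C\<close>, and subtracting the
  \<open>T\<close>-part of a vector of \<open>S\<close> leaves its \<open>C\<close>-part.\<close>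

lemma relative_dual_basis_exists:
  fixes s :: "'k::field \<Rightarrow> 'v::ab_group_add \<Rightarrow> 'v"
  assumes s: "vector_space s" and U: "module.subspace s U" and "U \<subseteq> S"
    and "finite B" and S: "S = module.span s B"
  shows "\<exists>T \<phi>. relative_dual_basis s U S T \<phi>"
proof -
  interpret s: vector_space s by fact
  obtain C where C: "finite C" "s.independent C" "U = s.span C"
    using subspace_finite_span[OF s assms(4) _ U] assms(3) S by blast
  have CS: "C \<subseteq> S" using C(3) assms(3) s.span_superset by blast
  obtain D where D: "C \<subseteq> D" "D \<subseteq> S" "s.independent D" "S \<subseteq> s.span D"
    using s.maximal_independent_subset_extend[OF CS C(2)] by blast
  have finD: "finite D"
    using s.independent_span_bound[OF assms(4) D(3)] D(2) S by blast
  define E where "E = s.extend_basis D"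
  have E: "D \<subseteq> E" "s.independent E" "s.span E = UNIV"
    using s.extend_basis_superset[OF D(3)] s.independent_extend_basis[OF D(3)]
      s.span_extend_basis[OF D(3)] by (auto simp: E_def)
  define \<phi> where "\<phi> t v = s.representation E v t" for t v
  show ?thesis
    unfolding relative_dual_basis_def
  proof (intro exI[of _ "D - C"] exI[of _ \<phi>] conjI ballI)
    show "finite (D - C)" "D - C \<subseteq> S" using finD D(2) by auto
    show "linear_between s UNIV (*) UNIV (\<phi> t)" for t
      using E by (simp add: linear_between_def \<phi>_def s.representation_add s.representation_scale)
    show "\<phi> t t' = (if t = t' then 1 else 0)" if "t \<in> D - C" "t' \<in> D - C" for t t'
      using s.representation_basis[OF E(2), of t'] that E(1) by (auto simp: \<phi>_def)
    show "\<phi> t u = 0" if "t \<in> D - C" "u \<in> U" for t u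
      using s.representation_extend[OF E(2), of u C] s.representation_ne_zero[of C u t] that C(3) D(1) E(1)
      by (auto simp: \<phi>_def)
    show "v - (\<Sum>t\<in>D - C. s (\<phi> t v) t) \<in> U" if "v \<in> S" for v
    proof -
      have "s.representation E v = s.representation D v"
        using s.representation_extend[OF E(2) _ E(1)] that D(4) by blast
      then have "(\<Sum>t\<in>D. s (\<phi> t v) t) = v"
        using s.sum_representation_eq[OF D(3) _ finD] that D(4) by (auto simp: \<phi>_def)
      then have "v - (\<Sum>t\<in>D - C. s (\<phi> t v) t) = (\<Sum>t\<in>C. s (\<phi> t v) t)"
        using sum.subset_diff[OF D(1) finD, of "\<lambda>t. s (\<phi> t v) t"] by (simp add: algebra_simps)
      also have "\<dots> \<in> U" unfolding C(3) by (intro s.span_sum s.span_scale s.span_base)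
      finally show ?thesis .
    qed
  qed
qed

text \<open>Compose \<open>\<psi>\<close> with a linear left inverse of \<open>g\<close>, chosen
  with range inside \<open>V\<close> because \<open>\<psi>\<close> is only known to be linear there.
  This is what makes cofree representations injective.\<close>

lemma extend_functional_along_inj:
  fixes s :: "'k::field \<Rightarrow> 'v::ab_group_add \<Rightarrow> 'v" and t :: "'k \<Rightarrow> 'w::ab_group_add \<Rightarrow> 'w"
  assumes s: "vector_space s" and t: "vector_space t" and V: "module.subspace s V"
    and g: "linear_between s V t W g" "inj_on g V"
    and \<psi>: "linear_between s V (*) UNIV \<psi>"
  obtains \<psi>' where "linear_between t UNIV (*) UNIV \<psi>'" "\<And>v. v \<in> V \<Longrightarrow> \<psi>' (g v) = \<psi> v"
proof -
  interpret s: vector_space s by fact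
  interpret t: vector_space t by fact
  interpret p: vector_space_pair s t ..
  obtain G where G: "Vector_Spaces.linear s t G" "\<And>v. v \<in> V \<Longrightarrow> G v = g v"
    using linear_between_extend[OF s t V g(1)] by blast
  have "inj_on G V" using g(2) G(2) by (simp add: inj_on_def)
  then obtain h where h: "range h \<subseteq> V" "Vector_Spaces.linear t s h" "\<And>v. v \<in> V \<Longrightarrow> h (G v) = v"
    using p.linear_exists_left_inverse_on[OF G(1) V] by blast
  interpret h: Vector_Spaces.linear t s h by fact
  show thesis
  proof (rule that[of "\<lambda>v. \<psi> (h v)"])
    show "linear_between t UNIV (*) UNIV (\<lambda>v. \<psi> (h v))"
      using \<psi> h(1) by (simp add: linear_between_def h.add h.scale image_subset_iff)
    show "\<psi> (h (g v)) = \<psi> v" if "v \<in> V" for v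
      using h(3) G(2) that by simp
  qed
qed


section \<open>Representations and homomorphisms\<close>

lemma mod_vector_space: "is_mod M \<Longrightarrow> vector_space (scal M)"
  by (simp add: is_mod_def)

lemma mod_finite_span:
  assumes "is_mod M" obtains B where "finite B" "spc M x = module.span (scal M) B"
proof -
  have "\<exists>B. finite B \<and> spc M x = module.span (scal M) B" using assms by (simp add: is_mod_def)
  then show thesis using that by blast
qed

lemma mod_subspace:
  assumes "is_mod M" shows "module.subspace (scal M) (spc M x)"
proof -
  interpret vector_space "scal M" using assms by (rule mod_vector_space)
  show ?thesis using mod_finite_span[OF assms] subspace_span by metis
qed

lemma act_linear: "is_mod M \<Longrightarrow> x \<le> y \<Longrightarrow>
    linear_between (scal M) (spc M x) (scal M) (spc M y) (act M x y)"
  by (simp add: is_mod_def)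

lemma act_closed: "is_mod M \<Longrightarrow> x \<le> y \<Longrightarrow> v \<in> spc M x \<Longrightarrow> act M x y v \<in> spc M y"
  using act_linear[of M x y] by (auto simp: linear_between_def)

lemma act_add: "is_mod M \<Longrightarrow> x \<le> y \<Longrightarrow> u \<in> spc M x \<Longrightarrow> v \<in> spc M x \<Longrightarrow>
    act M x y (u + v) = act M x y u + act M x y v"
  using act_linear[of M x y] by (auto simp: linear_between_def)

lemma act_scal: "is_mod M \<Longrightarrow> x \<le> y \<Longrightarrow> v \<in> spc M x \<Longrightarrow>
    act M x y (scal M c v) = scal M c (act M x y v)"
  using act_linear[of M x y] by (auto simp: linear_between_def)

lemma act_id: "is_mod M \<Longrightarrow> v \<in> spc M x \<Longrightarrow> act M x x v = v"
  by (simp add: is_mod_def)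

lemma act_act: "is_mod M \<Longrightarrow> x \<le> y \<Longrightarrow> y \<le> z \<Longrightarrow> v \<in> spc M x \<Longrightarrow>
    act M y z (act M x y v) = act M x z v"
  by (simp add: is_mod_def)

lemma
  assumes M: "is_mod M"
  shows mod_zero: "0 \<in> spc M x"
    and mod_scal_closed: "v \<in> spc M x \<Longrightarrow> scal M c v \<in> spc M x"
    and mod_add_closed: "u \<in> spc M x \<Longrightarrow> v \<in> spc M x \<Longrightarrow> u + v \<in> spc M x"
    and mod_diff_closed: "u \<in> spc M x \<Longrightarrow> v \<in> spc M x \<Longrightarrow> u - v \<in> spc M x"
proof -
  interpret vector_space "scal M" using M by (rule mod_vector_space)
  note S = mod_subspace[OF M, of x]
  show "0 \<in> spc M x" using subspace_0[OF S] .
  show "v \<in> spc M x \<Longrightarrow> scal M c v \<in> spc M x" using subspace_scale[OF S] .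
  show "u \<in> spc M x \<Longrightarrow> v \<in> spc M x \<Longrightarrow> u + v \<in> spc M x" using subspace_add[OF S] .
  show "u \<in> spc M x \<Longrightarrow> v \<in> spc M x \<Longrightarrow> u - v \<in> spc M x" using subspace_diff[OF S] .
qed

lemma mod_sum_closed: "is_mod M \<Longrightarrow> (\<And>i. i \<in> J \<Longrightarrow> v i \<in> spc M x) \<Longrightarrow> sum v J \<in> spc M x"
  by (induction J rule: infinite_finite_induct) (auto simp: mod_zero mod_add_closed)

lemma act_zero: "is_mod M \<Longrightarrow> x \<le> y \<Longrightarrow> act M x y 0 = 0"
  using linear_between_zero[OF mod_vector_space mod_vector_space mod_subspace act_linear] by blast

lemma act_sum: "is_mod M \<Longrightarrow> x \<le> y \<Longrightarrow> (\<And>i. i \<in> J \<Longrightarrow> v i \<in> spc M x) \<Longrightarrow>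
    act M x y (sum v J) = (\<Sum>i\<in>J. act M x y (v i))"
  by (induction J rule: infinite_finite_induct) (auto simp: act_zero act_add mod_sum_closed)

lemma hom_linear: "is_hom f M N \<Longrightarrow> linear_between (scal M) (spc M x) (scal N) (spc N x) (f x)"
  by (simp add: is_hom_def)

lemma hom_closed: "is_hom f M N \<Longrightarrow> v \<in> spc M x \<Longrightarrow> f x v \<in> spc N x"
  by (auto simp: is_hom_def linear_between_def image_subset_iff)

lemma hom_add: "is_hom f M N \<Longrightarrow> u \<in> spc M x \<Longrightarrow> v \<in> spc M x \<Longrightarrow> f x (u + v) = f x u + f x v"
  by (auto simp: is_hom_def linear_between_def image_subset_iff)

lemma hom_scal: "is_hom f M N \<Longrightarrow> v \<in> spc M x \<Longrightarrow> f x (scal M c v) = scal N c (f x v)"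
  by (auto simp: is_hom_def linear_between_def image_subset_iff)

lemma hom_act: "is_hom f M N \<Longrightarrow> x \<le> y \<Longrightarrow> v \<in> spc M x \<Longrightarrow> f y (act M x y v) = act N x y (f x v)"
  by (simp add: is_hom_def)

lemma homI:
  assumes "\<And>x v. v \<in> spc M x \<Longrightarrow> f x v \<in> spc N x"
    and "\<And>x u v. u \<in> spc M x \<Longrightarrow> v \<in> spc M x \<Longrightarrow> f x (u + v) = f x u + f x v"
    and "\<And>x c v. v \<in> spc M x \<Longrightarrow> f x (scal M c v) = scal N c (f x v)"
    and "\<And>x y v. x \<le> y \<Longrightarrow> v \<in> spc M x \<Longrightarrow> f y (act M x y v) = act N x y (f x v)"
  shows "is_hom f M N"
  unfolding is_hom_def linear_between_def using assms by (simp add: image_subset_iff)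

lemma hom_zero: "is_mod M \<Longrightarrow> is_mod N \<Longrightarrow> is_hom f M N \<Longrightarrow> f x 0 = 0"
  using linear_between_zero[OF mod_vector_space mod_vector_space mod_subspace hom_linear] by blast

lemma hom_diff:
  assumes "is_mod M" "is_hom f M N" "u \<in> spc M x" "v \<in> spc M x"
  shows "f x (u - v) = f x u - f x v"
  using hom_add[OF assms(2) mod_diff_closed[OF assms(1,3,4)] assms(4)] by simp

lemma hom_sum:
  assumes "is_mod M" "is_mod N" "is_hom f M N" "\<And>i. i \<in> J \<Longrightarrow> v i \<in> spc M x"
  shows "f x (sum v J) = (\<Sum>i\<in>J. f x (v i))"
  using assms(4)
  by (induction J rule: infinite_finite_induct)
    (auto simp: hom_zero[OF assms(1-3)] hom_add[OF assms(3)] mod_sum_closed[OF assms(1)])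

lemma hom_inj_iff:
  assumes "is_mod M" "is_mod N" "is_hom f M N"
  shows "inj_on (f x) (spc M x) \<longleftrightarrow> (\<forall>v\<in>spc M x. f x v = 0 \<longrightarrow> v = 0)"
proof
  assume "inj_on (f x) (spc M x)"
  then show "\<forall>v\<in>spc M x. f x v = 0 \<longrightarrow> v = 0"
    using hom_zero[OF assms] mod_zero[OF assms(1)] by (metis inj_onD)
next
  assume *: "\<forall>v\<in>spc M x. f x v = 0 \<longrightarrow> v = 0"
  show "inj_on (f x) (spc M x)"
  proof (rule inj_onI)
    fix u v assume "u \<in> spc M x" "v \<in> spc M x" "f x u = f x v"
    then have "f x (u - v) = 0" "u - v \<in> spc M x"
      by (simp_all add: hom_diff[OF assms(1,3)] mod_diff_closed[OF assms(1)])
    with * have "u - v = 0" by blast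
    then show "u = v" by simp
  qed
qed

lemma hom_comp:
  assumes f: "is_hom f L M" and g: "is_hom g M N"
  shows "is_hom (\<lambda>x v. g x (f x v)) L N"
  by (intro homI)
    (simp_all add: hom_closed[OF f] hom_closed[OF g] hom_add[OF f] hom_add[OF g]
      hom_scal[OF f] hom_scal[OF g] hom_act[OF f] hom_act[OF g])

text \<open>Each component is an endomorphism of a finite-dimensional space. The comparison of
  resolutions draws on finite dimension through this equivalence.\<close>

lemma epi_endo_iff_mono_endo:
  assumes M: "is_mod M"
  shows "is_epi f M M \<longleftrightarrow> is_mono f M M"
proof -
  have "f x ` spc M x = spc M x \<longleftrightarrow> inj_on (f x) (spc M x)" if f: "is_hom f M M" for x
  proof -
    obtain B where B: "finite B" "spc M x = module.span (scal M) B"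
      using mod_finite_span[OF M] by blast
    show ?thesis
      using inj_endo_imp_surj[OF mod_vector_space[OF M] B hom_linear[OF f]]
        surj_endo_imp_inj[OF mod_vector_space[OF M] B hom_linear[OF f]] by blast
  qed
  then show ?thesis unfolding is_epi_def is_mono_def by blast
qed

text \<open>Each law for \<open>g\<close> is checked by writing its right-hand side as
  \<open>g\<close> of an image under \<open>f\<close>, where the corresponding law of
  \<open>f\<close> applies.\<close>

lemma isomorphic_inverse:
  assumes M: "is_mod M" and f: "is_mono f M N" "is_epi f M N"
  obtains g where "is_hom g N M" "\<And>x v. v \<in> spc M x \<Longrightarrow> g x (f x v) = v"
    "\<And>x w. w \<in> spc N x \<Longrightarrow> f x (g x w) = w"
proof -
  define g where "g x = inv_into (spc M x) (f x)" for x
  have hf: "is_hom f M N" using f by (simp add: is_mono_def)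
  have im: "f x ` spc M x = spc N x" for x using f by (simp add: is_epi_def)
  have gf: "g x (f x v) = v" if "v \<in> spc M x" for x v
    using f(1) that by (simp add: g_def is_mono_def)
  have fg: "f x (g x w) = w" if "w \<in> spc N x" for x w
    using f_inv_into_f[of w "f x" "spc M x"] im that by (simp add: g_def)
  have gc: "g x w \<in> spc M x" if "w \<in> spc N x" for x w
    using inv_into_into[of w "f x" "spc M x"] im that by (simp add: g_def)
  have "is_hom g N M"
  proof (rule homI)
    show "g x w \<in> spc M x" if "w \<in> spc N x" for x w using gc that .
    show "g x (u + w) = g x u + g x w" if "u \<in> spc N x" "w \<in> spc N x" for x u w
      using gf[of "g x u + g x w" x] that by (simp add: gc fg hom_add[OF hf] mod_add_closed[OF M])
    show "g x (scal N c w) = scal M c (g x w)" if "w \<in> spc N x" for x c w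
      using gf[of "scal M c (g x w)" x] that by (simp add: gc fg hom_scal[OF hf] mod_scal_closed[OF M])
    show "g y (act N x y w) = act M x y (g x w)" if "x \<le> y" "w \<in> spc N x" for x y w
      using gf[of "act M x y (g x w)" y] that by (simp add: gc fg hom_act[OF hf] act_closed[OF M])
  qed
  then show thesis using gf fg by (rule that)
qed


section \<open>Subrepresentations\<close>

lemma sub_of_simps [simp]:
  "scal (sub_of M U) = scal M" "spc (sub_of M U) = U" "act (sub_of M U) = act M"
  by (simp_all add: sub_of_def)

lemma sub_subset: "is_sub U M \<Longrightarrow> v \<in> U x \<Longrightarrow> v \<in> spc M x"
  unfolding is_sub_def by blast

lemma sub_act: "is_sub U M \<Longrightarrow> x \<le> y \<Longrightarrow> v \<in> U x \<Longrightarrow> act M x y v \<in> U y"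
  unfolding is_sub_def by blast

lemma sub_mod:
  assumes M: "is_mod M" and U: "is_sub U M"
  shows "is_mod (sub_of M U)"
  unfolding is_mod_def sub_of_simps
proof (intro conjI allI impI ballI)
  show "vector_space (scal M)" using M by (rule mod_vector_space)
  show "\<exists>B. finite B \<and> U x = module.span (scal M) B" for x
  proof -
    obtain B where B: "finite B" "spc M x = module.span (scal M) B"
      using mod_finite_span[OF M] by blast
    have "module.subspace (scal M) (U x)" "U x \<subseteq> module.span (scal M) B"
      using U B(2) by (auto simp: is_sub_def)
    from subspace_finite_span[OF mod_vector_space[OF M] B(1) this(2,1)] show ?thesis by blast
  qed
  show "linear_between (scal M) (U x) (scal M) (U y) (act M x y)" if "x \<le> y" for x y
    using sub_subset[OF U, of _ x] sub_act[OF U that] act_add[OF M that] act_scal[OF M that]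
    by (auto simp: linear_between_def)
  show "act M x x v = v" if "v \<in> U x" for x v
    using act_id[OF M sub_subset[OF U that]] .
  show "act M y z (act M x y v) = act M x z v" if "x \<le> y" "y \<le> z" "v \<in> U x" for x y z v
    using act_act[OF M that(1,2) sub_subset[OF U that(3)]] .
qed

lemma
  assumes M: "is_mod M" and U: "is_sub U M"
  shows sub_zero_mem: "0 \<in> U x"
    and sub_add: "u \<in> U x \<Longrightarrow> v \<in> U x \<Longrightarrow> u + v \<in> U x"
    and sub_scal: "v \<in> U x \<Longrightarrow> scal M c v \<in> U x"
    and sub_diff: "u \<in> U x \<Longrightarrow> v \<in> U x \<Longrightarrow> u - v \<in> U x"
  using mod_zero[OF sub_mod[OF M U]] mod_add_closed[OF sub_mod[OF M U]]
    mod_scal_closed[OF sub_mod[OF M U]] mod_diff_closed[OF sub_mod[OF M U]]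
  by simp_all

lemma sub_sum_closed: "is_mod M \<Longrightarrow> is_sub U M \<Longrightarrow> (\<And>i. i \<in> J \<Longrightarrow> w i \<in> U x) \<Longrightarrow> sum w J \<in> U x"
  by (induction J rule: infinite_finite_induct) (simp_all add: sub_zero_mem sub_add)

lemma subI:
  assumes M: "is_mod M"
    and "\<And>x. 0 \<in> U x" "\<And>x u v. u \<in> U x \<Longrightarrow> v \<in> U x \<Longrightarrow> u + v \<in> U x"
    and "\<And>x c v. v \<in> U x \<Longrightarrow> scal M c v \<in> U x"
    and "\<And>x v. v \<in> U x \<Longrightarrow> v \<in> spc M x"
    and "\<And>x y v. x \<le> y \<Longrightarrow> v \<in> U x \<Longrightarrow> act M x y v \<in> U y"
  shows "is_sub U M"
proof -
  interpret vector_space "scal M" using M by (rule mod_vector_space)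
  show ?thesis unfolding is_sub_def subspace_def using assms(2-) by (auto simp: image_subset_iff)
qed

lemma sub_whole: "is_mod M \<Longrightarrow> is_sub (spc M) M"
  by (intro subI) (simp_all add: mod_zero mod_add_closed mod_scal_closed act_closed)

lemma sub_null: "is_mod M \<Longrightarrow> is_sub (\<lambda>x. {0}) M"
proof -
  assume M: "is_mod M"
  interpret vector_space "scal M" using M by (rule mod_vector_space)
  show ?thesis using M by (intro subI) (auto simp: mod_zero act_zero)
qed

text \<open>The restriction to \<open>U\<close> covers several uses at once: kernels
  (\<open>U\<close> everything, \<open>W\<close> zero), preimages of maximal subobjects
  (\<open>U\<close> everything), and the part of a simple subobject that is mapped into
  \<open>W\<close>.\<close>

lemma preim_sub:
  assumes M: "is_mod M" and N: "is_mod N" and f: "is_hom f M N" and U: "is_sub U M" and W: "is_sub W N"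
  shows "is_sub (\<lambda>x. {v \<in> U x. f x v \<in> W x}) M"
proof (rule subI[OF M])
  show "0 \<in> {v \<in> U x. f x v \<in> W x}" for x
    by (simp add: sub_zero_mem[OF M U] sub_zero_mem[OF N W] hom_zero[OF M N f])
qed (auto simp: sub_add[OF M U] sub_add[OF N W] sub_scal[OF M U] sub_scal[OF N W] sub_subset[OF U]
    sub_act[OF U] sub_act[OF W] hom_add[OF f] hom_scal[OF f] hom_act[OF f])

lemma ker_sub:
  assumes M: "is_mod M" and N: "is_mod N" and f: "is_hom f M N"
  shows "is_sub (ker_of f M) M"
  using preim_sub[OF M N f sub_whole[OF M] sub_null[OF N]] by (simp add: ker_of_def)

lemma im_sub: "is_mod M \<Longrightarrow> is_mod N \<Longrightarrow> is_hom f M N \<Longrightarrow> is_sub U M \<Longrightarrow> is_sub (\<lambda>x. f x ` U x) N"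
proof (rule subI)
  assume M: "is_mod M" and N: "is_mod N" and f: "is_hom f M N" and U: "is_sub U M"
  show "is_mod N" by fact
  show "0 \<in> f x ` U x" for x
    using sub_zero_mem[OF M U] hom_zero[OF M N f] by (metis image_eqI)
  show "u + v \<in> f x ` U x" if uv: "u \<in> f x ` U x" "v \<in> f x ` U x" for x u v
  proof -
    obtain u' v' where "u' \<in> U x" "u = f x u'" "v' \<in> U x" "v = f x v'" using uv by blast
    then show ?thesis
      by (intro image_eqI[of _ _ "u' + v'"]) (simp_all add: sub_add[OF M U] hom_add[OF f] sub_subset[OF U])
  qed
  show "scal N c v \<in> f x ` U x" if v: "v \<in> f x ` U x" for x c v
  proof -
    obtain v' where "v' \<in> U x" "v = f x v'" using v by blast
    then show ?thesis
      by (intro image_eqI[of _ _ "scal M c v'"]) (simp_all add: sub_scal[OF M U] hom_scal[OF f] sub_subset[OF U])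
  qed
  show "v \<in> spc N x" if "v \<in> f x ` U x" for x v
    using that hom_closed[OF f] sub_subset[OF U] by blast
  show "act N x y v \<in> f y ` U y" if xy: "x \<le> y" and v: "v \<in> f x ` U x" for x y v
  proof -
    obtain v' where "v' \<in> U x" "v = f x v'" using v by blast
    then show ?thesis
      by (intro image_eqI[of _ _ "act M x y v'"]) (simp_all add: xy sub_act[OF U] hom_act[OF f] sub_subset[OF U])
  qed
qed

lemma im_of_sub: "is_mod M \<Longrightarrow> is_mod N \<Longrightarrow> is_hom f M N \<Longrightarrow> is_sub (im_of f M) N"
  unfolding im_of_def by (rule im_sub[OF _ _ _ sub_whole])

lemma hom_restrict:
  assumes f: "is_hom f M N" and U: "is_sub U M"
  shows "is_hom f (sub_of M U) N"
  by (intro homI) (auto simp: hom_closed[OF f] hom_add[OF f] hom_scal[OF f] hom_act[OF f] sub_subset[OF U])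

lemma hom_corestrict:
  assumes f: "is_hom f M N" and "\<And>x v. v \<in> spc M x \<Longrightarrow> f x v \<in> U x"
  shows "is_hom f M (sub_of N U)"
  by (intro homI) (auto simp: assms(2) hom_add[OF f] hom_scal[OF f] hom_act[OF f])

lemma hom_extend_codomain:
  assumes f: "is_hom f M (sub_of N U)" and U: "is_sub U N"
  shows "is_hom f M N"
  using hom_closed[OF f] hom_add[OF f] hom_scal[OF f] hom_act[OF f]
  by (intro homI) (auto simp: sub_subset[OF U])

lemma epi_onto_image: "is_hom f M N \<Longrightarrow> is_epi f M (sub_of N (im_of f M))"
  unfolding is_epi_def by (auto simp: im_of_def intro: hom_corestrict)


section \<open>Top and socle under epi- and monomorphisms\<close>

text \<open>Since \<open>0\<close> lies in the radical, a coset equals the radical only if its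
  representative lies in it; conversely a space is invariant under translation by its own
  elements.\<close>

lemma supp_top_iff:
  assumes M: "is_mod M"
  shows "x \<in> supp_top M \<longleftrightarrow> \<not> spc M x \<subseteq> rad M x"
proof -
  have 0: "0 \<in> rad M x"
    using mod_zero[OF M] sub_zero_mem[OF M] by (auto simp: rad_def maximal_sub_def)
  have "top_spc M x = {rad M x} \<longleftrightarrow> spc M x \<subseteq> rad M x"
  proof
    assume L: "top_spc M x = {rad M x}"
    show "spc M x \<subseteq> rad M x"
    proof
      fix v assume "v \<in> spc M x"
      then have "(+) v ` rad M x = rad M x" using L by (auto simp: top_spc_def)
      then show "v \<in> rad M x" using 0 by (metis add.right_neutral image_eqI)
    qed
  next
    assume "spc M x \<subseteq> rad M x"
    then have R: "rad M x = spc M x" by (auto simp: rad_def)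
    have "(+) v ` spc M x = spc M x" if v: "v \<in> spc M x" for v
    proof
      show "(+) v ` spc M x \<subseteq> spc M x" using mod_add_closed[OF M v] by blast
      show "spc M x \<subseteq> (+) v ` spc M x"
      proof
        fix w assume "w \<in> spc M x"
        then have "w - v \<in> spc M x" using mod_diff_closed[OF M] v by blast
        then show "w \<in> (+) v ` spc M x" by (rule rev_image_eqI) simp
      qed
    qed
    then show "top_spc M x = {rad M x}"
      unfolding top_spc_def R using mod_zero[OF M, of x] by auto
  qed
  then show ?thesis by (simp add: supp_top_def)
qed

text \<open>The correspondence theorem: a subobject \<open>W\<close> above the preimage of
  \<open>U\<close> contains the kernel, so it is recovered from its image, which lies between
  \<open>U\<close> and \<open>P\<close>.\<close>

lemma maximal_sub_preimage:
  assumes Q: "is_mod Q" and P: "is_mod P" and f: "is_epi f Q P" and U: "maximal_sub U P"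
  shows "maximal_sub (\<lambda>x. {q \<in> spc Q x. f x q \<in> U x}) Q"
proof -
  let ?V = "\<lambda>x. {q \<in> spc Q x. f x q \<in> U x}"
  have hf: "is_hom f Q P" and im: "\<And>x. f x ` spc Q x = spc P x" using f by (auto simp: is_epi_def)
  have Us: "is_sub U P" and Un: "U \<noteq> spc P" using U by (auto simp: maximal_sub_def)
  have V: "is_sub ?V Q" by (rule preim_sub[OF Q P hf sub_whole[OF Q] Us])
  have fV: "f x ` ?V x = U x" for x
  proof
    show "f x ` ?V x \<subseteq> U x" by blast
    show "U x \<subseteq> f x ` ?V x"
    proof
      fix u assume u: "u \<in> U x"
      then have "u \<in> f x ` spc Q x" using im sub_subset[OF Us] by simp
      with u show "u \<in> f x ` ?V x" by auto
    qed
  qed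
  have "?V \<noteq> spc Q"
  proof
    assume *: "?V = spc Q"
    have "U x = spc P x" for x using fV[of x] im[of x] fun_cong[OF *, of x] by simp
    then have "U = spc P" by (rule ext)
    with Un show False by simp
  qed
  moreover have "W = ?V \<or> W = spc Q" if W: "is_sub W Q" and VW: "\<forall>x. ?V x \<subseteq> W x" for W
  proof -
    have "is_sub (\<lambda>x. f x ` W x) P" by (rule im_sub[OF Q P hf W])
    moreover have "U x \<subseteq> f x ` W x" for x
      using image_mono[of "?V x" "W x" "f x"] fV[of x] VW by simp
    ultimately consider "(\<lambda>x. f x ` W x) = U" | "(\<lambda>x. f x ` W x) = spc P"
      using U unfolding maximal_sub_def by blast
    then show ?thesis
    proof cases
      case 1
      then have "f x ` W x \<subseteq> U x" for x by (auto dest: fun_cong[of _ _ x])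
      then have "W x = ?V x" for x using VW sub_subset[OF W, of _ x] by auto
      then have "W = ?V" by (rule ext)
      then show ?thesis ..
    next
      case 2
      have "q \<in> W x" if q: "q \<in> spc Q x" for x q
      proof -
        obtain w where w: "w \<in> W x" "f x q = f x w"
          using fun_cong[OF 2, of x] hom_closed[OF hf q] by auto
        \<comment> \<open>\<open>q\<close> and \<open>w\<close> have the same image, so their
          difference is in the kernel, which the preimage contains because \<open>0\<close> lies in
          \<open>U x\<close>.\<close>
        have "q - w \<in> ?V x"
          using w q hom_diff[OF Q hf q] sub_subset[OF W] mod_diff_closed[OF Q] sub_zero_mem[OF P Us] by simp
        then have "(q - w) + w \<in> W x" using sub_add[OF Q W] VW w by blast
        then show ?thesis by simp
      qed
      then have "W x = spc Q x" for x using sub_subset[OF W, of _ x] by blast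
      then have "W = spc Q" by (rule ext)
      then show ?thesis ..
    qed
  qed
  ultimately show ?thesis using V unfolding maximal_sub_def by blast
qed

lemma epi_supp_top:
  assumes Q: "is_mod Q" and P: "is_mod P" and f: "is_epi f Q P"
  shows "supp_top P \<subseteq> supp_top Q"
proof
  fix x assume "x \<in> supp_top P"
  then obtain p where p: "p \<in> spc P x" "p \<notin> rad P x" using supp_top_iff[OF P] by blast
  then obtain U where U: "maximal_sub U P" "p \<notin> U x" by (auto simp: rad_def)
  obtain q where q: "q \<in> spc Q x" "p = f x q" using f p(1) unfolding is_epi_def by blast
  then have "q \<notin> rad Q x"
    using maximal_sub_preimage[OF Q P f U(1)] U(2) by (auto simp: rad_def)
  then show "x \<in> supp_top Q" using supp_top_iff[OF Q] q by blast
qed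

text \<open>A subobject of the image is the image of its preimage in \<open>U\<close>, and
  simplicity leaves only two choices for that preimage.\<close>

lemma simple_sub_image:
  assumes P: "is_mod P" and Q: "is_mod Q" and f: "is_mono f P Q" and U: "simple_sub U P"
  shows "simple_sub (\<lambda>x. f x ` U x) Q"
proof -
  have hf: "is_hom f P Q" and inj: "\<And>x. inj_on (f x) (spc P x)" using f by (auto simp: is_mono_def)
  have Us: "is_sub U P" and Un: "U \<noteq> sub_zero" using U by (auto simp: simple_sub_def)
  have f0: "f x v = 0 \<Longrightarrow> v = 0" if "v \<in> U x" for x v
    using inj hom_inj_iff[OF P Q hf] sub_subset[OF Us that] by blast
  obtain x u where u: "u \<in> U x" "u \<noteq> 0"
    using Un sub_zero_mem[OF P Us] unfolding sub_zero_def by blast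
  then have "(\<lambda>x. f x ` U x) \<noteq> sub_zero"
    using f0 unfolding sub_zero_def by (metis imageI singletonD)
  moreover have "W = sub_zero \<or> W = (\<lambda>x. f x ` U x)"
    if W: "is_sub W Q" and WU: "\<forall>x. W x \<subseteq> f x ` U x" for W
  proof -
    let ?V = "\<lambda>x. {v \<in> U x. f x v \<in> W x}"
    have "is_sub ?V P" by (rule preim_sub[OF P Q hf Us W])
    then have "?V = sub_zero \<or> ?V = U" using U unfolding simple_sub_def by blast
    moreover have "f x ` ?V x = W x" for x using WU by blast
    ultimately show ?thesis
      using hom_zero[OF P Q hf] by (force simp: sub_zero_def fun_eq_iff)
  qed
  ultimately show ?thesis using im_sub[OF P Q hf Us] unfolding simple_sub_def by blast
qed

text \<open>A sum of subspaces vanishes exactly when each of them does, so a nonzero socle at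
  \<open>x\<close> is witnessed by a single simple subobject.\<close>

lemma supp_soc_iff:
  assumes M: "is_mod M"
  shows "x \<in> supp (soc M) \<longleftrightarrow> (\<exists>U u. simple_sub U M \<and> u \<in> U x \<and> u \<noteq> 0)"
proof -
  interpret vector_space "scal M" using M by (rule mod_vector_space)
  let ?S = "\<Union>U\<in>{U. simple_sub U M}. U x"
  have "span ?S = {0} \<longleftrightarrow> ?S \<subseteq> {0}"
    using span_superset[of ?S] span_minimal[of ?S "{0}"] span_zero[of ?S] subspace_single_0 by blast
  then show ?thesis by (auto simp: supp_def soc_def)
qed

lemma mono_supp_soc:
  assumes P: "is_mod P" and Q: "is_mod Q" and f: "is_mono f P Q"
  shows "supp (soc P) \<subseteq> supp (soc Q)"
proof
  fix x assume "x \<in> supp (soc P)"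
  then obtain U u where U: "simple_sub U P" "u \<in> U x" "u \<noteq> 0" using supp_soc_iff[OF P] by blast
  have "u \<in> spc P x" using U sub_subset unfolding simple_sub_def by blast
  then have "f x u \<noteq> 0" using f hom_inj_iff[OF P Q] U(3) unfolding is_mono_def by blast
  then show "x \<in> supp (soc Q)"
    using supp_soc_iff[OF Q] simple_sub_image[OF P Q f U(1)] U(2) by blast
qed


section \<open>Free and cofree representations\<close>

definition fscal :: "'k::field \<Rightarrow> (nat \<Rightarrow> 'k) \<Rightarrow> nat \<Rightarrow> 'k"
  where "fscal c f = (\<lambda>n. c * f n)"

definition unit_fun :: "nat \<Rightarrow> nat \<Rightarrow> 'k::field"
  where "unit_fun n = (\<lambda>i. if i = n then 1 else 0)"

text \<open>\<open>free_rep m \<beta>\<close> is the direct sum of the indecomposable projectives generated at \<open>\<beta> n\<close>,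
  \<open>n < m\<close>, and \<open>cofree_rep m \<beta>\<close> that of the indecomposable injectives cogenerated there.\<close>

definition free_rep :: "nat \<Rightarrow> (nat \<Rightarrow> 'p) \<Rightarrow> ('p::{finite,order}, 'k::field) urep"
  where "free_rep m \<beta> =
    \<lparr>scal = fscal, spc = (\<lambda>z. {f. \<forall>n. f n \<noteq> 0 \<longrightarrow> n < m \<and> \<beta> n \<le> z}), act = (\<lambda>x y f. f)\<rparr>"

definition cofree_rep :: "nat \<Rightarrow> (nat \<Rightarrow> 'p) \<Rightarrow> ('p::{finite,order}, 'k::field) urep"
  where "cofree_rep m \<beta> =
    \<lparr>scal = fscal, spc = (\<lambda>z. {f. \<forall>n. f n \<noteq> 0 \<longrightarrow> n < m \<and> z \<le> \<beta> n}),
     act = (\<lambda>x y f n. if y \<le> \<beta> n then f n else 0)\<rparr>"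

text \<open>The Yoneda morphism given by vectors \<open>b n\<close> at the vertices
  \<open>\<beta> n\<close>: the generator \<open>unit_fun n\<close> goes to \<open>b n\<close>, and
  its translate at \<open>z\<close> to the translate of \<open>b n\<close>. Generators with
  \<open>\<beta> n\<close> not below \<open>z\<close> are absent at \<open>z\<close>.\<close>

definition free_map ::
  "('p::{finite,order}, 'k::field, 'v::ab_group_add) rep \<Rightarrow> nat \<Rightarrow> (nat \<Rightarrow> 'p) \<Rightarrow> (nat \<Rightarrow> 'v)
    \<Rightarrow> 'p \<Rightarrow> (nat \<Rightarrow> 'k) \<Rightarrow> 'v"
  where "free_map N m \<beta> b z f = (\<Sum>n | n < m \<and> \<beta> n \<le> z. scal N (f n) (act N (\<beta> n) z (b n)))"

text \<open>The dual Yoneda morphism: maps into the indecomposable injective at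
  \<open>\<beta> n\<close> correspond to functionals on the space at \<open>\<beta> n\<close>. The
  coordinate of \<open>v\<close> is found by first moving \<open>v\<close> up to
  \<open>\<beta> n\<close>, which makes sense only for \<open>z \<le> \<beta> n\<close>.\<close>

definition cofree_map ::
  "('p::{finite,order}, 'k::field, 'v::ab_group_add) rep \<Rightarrow> nat \<Rightarrow> (nat \<Rightarrow> 'p) \<Rightarrow> (nat \<Rightarrow> 'v \<Rightarrow> 'k)
    \<Rightarrow> 'p \<Rightarrow> 'v \<Rightarrow> nat \<Rightarrow> 'k"
  where "cofree_map N m \<beta> \<psi> z v = (\<lambda>n. if n < m \<and> z \<le> \<beta> n then \<psi> n (act N z (\<beta> n) v) else 0)"

lemma vector_space_fscal: "vector_space fscal"
  by unfold_locales (auto simp: fscal_def fun_eq_iff algebra_simps)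

lemma sum_fun_apply: "sum f A x = (\<Sum>i\<in>A. f i x)"
  by (induction A rule: infinite_finite_induct) auto

lemma sum_unit_fun:
  assumes "finite J" "\<And>n. f n \<noteq> 0 \<Longrightarrow> n \<in> J"
  shows "(\<Sum>n\<in>J. fscal (f n) (unit_fun n)) = f"
proof
  fix i
  have "(\<Sum>n\<in>J. f n * (if i = n then 1 else 0)) = (\<Sum>n\<in>J. if i = n then f n else 0)"
    by (rule sum.cong) auto
  also have "\<dots> = f i" using assms by auto
  finally show "(\<Sum>n\<in>J. fscal (f n) (unit_fun n)) i = f i"
    by (simp add: sum_fun_apply fscal_def unit_fun_def)
qed

lemma finite_support_span:
  assumes "finite J"
  shows "{f. \<forall>n. f n \<noteq> (0::'k::field) \<longrightarrow> n \<in> J} = module.span fscal (unit_fun ` J)"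
proof -
  interpret vector_space fscal by (rule vector_space_fscal)
  show ?thesis
  proof
    show "{f. \<forall>n. f n \<noteq> (0::'k) \<longrightarrow> n \<in> J} \<subseteq> span (unit_fun ` J)"
    proof
      fix f assume "f \<in> {f. \<forall>n. f n \<noteq> (0::'k) \<longrightarrow> n \<in> J}"
      then have "(\<Sum>n\<in>J. fscal (f n) (unit_fun n)) = f"
        by (intro sum_unit_fun assms) auto
      moreover have "(\<Sum>n\<in>J. fscal (f n) (unit_fun n)) \<in> span (unit_fun ` J)"
        by (intro span_sum span_scale span_base) auto
      ultimately show "f \<in> span (unit_fun ` J)" by simp
    qed
    show "span (unit_fun ` J) \<subseteq> {f. \<forall>n. f n \<noteq> (0::'k) \<longrightarrow> n \<in> J}"
    proof (rule span_minimal)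
      show "unit_fun ` J \<subseteq> {f. \<forall>n. f n \<noteq> (0::'k) \<longrightarrow> n \<in> J}"
        by (auto simp: unit_fun_def split: if_splits)
      show "subspace {f. \<forall>n. f n \<noteq> (0::'k) \<longrightarrow> n \<in> J}"
        by (rule subspaceI) (auto simp: fscal_def, metis add.left_neutral)
    qed
  qed
qed

lemma free_mod: "is_mod (free_rep m \<beta> :: ('p::{finite,order}, 'k::field) urep)"
proof -
  have "\<exists>B. finite B \<and> {f. \<forall>n. f n \<noteq> (0::'k) \<longrightarrow> n < m \<and> \<beta> n \<le> z} = module.span fscal B" for z
    using finite_support_span[of "{n. n < m \<and> \<beta> n \<le> z}"]
    by (intro exI[of _ "unit_fun ` {n. n < m \<and> \<beta> n \<le> z}"]) simp
  then show ?thesis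
    by (auto simp: is_mod_def free_rep_def vector_space_fscal linear_between_def intro: order_trans)
qed

lemma cofree_mod: "is_mod (cofree_rep m \<beta> :: ('p::{finite,order}, 'k::field) urep)"
proof -
  have "\<exists>B. finite B \<and> {f. \<forall>n. f n \<noteq> (0::'k) \<longrightarrow> n < m \<and> z \<le> \<beta> n} = module.span fscal B" for z
    using finite_support_span[of "{n. n < m \<and> z \<le> \<beta> n}"]
    by (intro exI[of _ "unit_fun ` {n. n < m \<and> z \<le> \<beta> n}"]) simp
  then show ?thesis
    by (auto simp: is_mod_def cofree_rep_def vector_space_fscal linear_between_def fscal_def fun_eq_iff
      intro: order_trans split: if_splits)
qed

lemma unit_fun_free: "n < m \<Longrightarrow> \<beta> n \<le> z \<Longrightarrow> unit_fun n \<in> spc (free_rep m \<beta>) z"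
  by (simp add: unit_fun_def free_rep_def)

lemma free_decomp:
  assumes "f \<in> spc (free_rep m \<beta>) z"
  shows "(\<Sum>n | n < m \<and> \<beta> n \<le> z. fscal (f n) (unit_fun n)) = f"
  using assms by (intro sum_unit_fun) (auto simp: free_rep_def)

lemma free_map_hom:
  fixes N :: "('p::{finite,order}, 'k::field, 'v::ab_group_add) rep"
  assumes N: "is_mod N" and b: "\<And>n. n < m \<Longrightarrow> b n \<in> spc N (\<beta> n)"
  shows "is_hom (free_map N m \<beta> b) (free_rep m \<beta>) N"
proof -
  interpret vector_space "scal N" using N by (rule mod_vector_space)
  show ?thesis
  proof (rule homI)
    show "free_map N m \<beta> b x v \<in> spc N x" for x v
      unfolding free_map_def
      by (intro mod_sum_closed[OF N] mod_scal_closed[OF N] act_closed[OF N]) (use b in auto)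
    show "free_map N m \<beta> b x (u + v) = free_map N m \<beta> b x u + free_map N m \<beta> b x v" for x u v
      by (simp add: free_map_def scale_left_distrib sum.distrib)
    show "free_map N m \<beta> b x (scal (free_rep m \<beta>) c v) = scal N c (free_map N m \<beta> b x v)" for x c v
      by (simp add: free_map_def free_rep_def fscal_def scale_sum_right)
    fix x y :: 'p and v :: "nat \<Rightarrow> 'k"
    assume xy: "x \<le> y" and v: "v \<in> spc (free_rep m \<beta>) x"
    have "act N x y (free_map N m \<beta> b x v)
      = (\<Sum>n | n < m \<and> \<beta> n \<le> x. act N x y (scal N (v n) (act N (\<beta> n) x (b n))))"
      unfolding free_map_def
      by (intro act_sum[OF N xy] mod_scal_closed[OF N] act_closed[OF N]) (use b in auto)
    also have "\<dots> = (\<Sum>n | n < m \<and> \<beta> n \<le> x. scal N (v n) (act N (\<beta> n) y (b n)))"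
      by (intro sum.cong refl) (use b xy in \<open>simp add: act_scal[OF N] act_act[OF N] act_closed[OF N]\<close>)
    \<comment> \<open>The sum for \<open>y\<close> has more indices, but the additional generators
      are not below \<open>x\<close>, so their coefficients in \<open>v\<close> vanish.\<close>
    also have "\<dots> = free_map N m \<beta> b y v"
      unfolding free_map_def
      by (rule sum.mono_neutral_left) (use v xy in \<open>auto simp: free_rep_def intro: order_trans\<close>)
    finally show "free_map N m \<beta> b y (act (free_rep m \<beta>) x y v) = act N x y (free_map N m \<beta> b x v)"
      by (simp add: free_rep_def)
  qed
qed

lemma free_map_unit:
  assumes N: "is_mod N" and "n < m" "\<beta> n \<le> z"
  shows "free_map N m \<beta> b z (unit_fun n) = act N (\<beta> n) z (b n)"
proof -
  interpret vector_space "scal N" using N by (rule mod_vector_space)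
  have "free_map N m \<beta> b z (unit_fun n)
    = (\<Sum>i | i < m \<and> \<beta> i \<le> z. if n = i then act N (\<beta> n) z (b n) else 0)"
    unfolding free_map_def unit_fun_def by (rule sum.cong) auto
  then show ?thesis using assms by simp
qed

text \<open>Uniqueness in the Yoneda lemma: expanding \<open>v\<close> in generators and moving each
  up from its own vertex expresses the value through the vectors
  \<open>h (\<beta> n) (unit_fun n)\<close> alone.\<close>

lemma free_hom_eqI:
  assumes N: "is_mod N" and f: "is_hom f (free_rep m \<beta>) N" and g: "is_hom g (free_rep m \<beta>) N"
    and eq: "\<And>n. n < m \<Longrightarrow> f (\<beta> n) (unit_fun n) = g (\<beta> n) (unit_fun n)"
    and v: "v \<in> spc (free_rep m \<beta>) z"
  shows "f z v = g z v"
proof -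
  note F = free_mod[of m \<beta>]
  have expand: "h z v = (\<Sum>n | n < m \<and> \<beta> n \<le> z. scal N (v n) (act N (\<beta> n) z (h (\<beta> n) (unit_fun n))))"
    if h: "is_hom h (free_rep m \<beta>) N" for h
  proof -
    have "h z (fscal c (unit_fun n)) = scal N c (act N (\<beta> n) z (h (\<beta> n) (unit_fun n)))"
      if "n < m" "\<beta> n \<le> z" for n c
    proof -
      have "h z (scal (free_rep m \<beta>) c (unit_fun n)) = scal N c (h z (unit_fun n))"
        using hom_scal[OF h unit_fun_free[of n m \<beta> z]] that by blast
      moreover have "h z (act (free_rep m \<beta>) (\<beta> n) z (unit_fun n)) = act N (\<beta> n) z (h (\<beta> n) (unit_fun n))"
        using hom_act[OF h that(2) unit_fun_free[of n m \<beta> "\<beta> n"]] that by blast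
      ultimately show ?thesis by (simp add: free_rep_def)
    qed
    moreover have "h z (\<Sum>n | n < m \<and> \<beta> n \<le> z. fscal (v n) (unit_fun n))
      = (\<Sum>n | n < m \<and> \<beta> n \<le> z. h z (fscal (v n) (unit_fun n)))"
    proof (rule hom_sum[OF F N h])
      fix n assume "n \<in> {n. n < m \<and> \<beta> n \<le> z}"
      then show "fscal (v n) (unit_fun n) \<in> spc (free_rep m \<beta>) z"
        by (simp add: free_rep_def fscal_def unit_fun_def)
    qed
    ultimately show ?thesis by (simp add: free_decomp[OF v])
  qed
  show ?thesis unfolding expand[OF f] expand[OF g] using eq by (intro sum.cong) auto
qed

text \<open>Surjectivity of \<open>g\<close> at the vertex \<open>\<beta> n\<close> lifts the image
  of the \<open>n\<close>-th generator; by freeness, lifts chosen independently for each generator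
  define a morphism.\<close>

lemma free_projective: "projective (free_rep m \<beta> :: ('p::{finite,order}, 'k::field) urep)"
  unfolding projective_def
proof (intro conjI allI impI)
  fix X Y :: "('p, 'k) urep" and g h
  assume X: "is_mod X" and Y: "is_mod Y" and g: "is_epi g X Y"
    and h: "is_hom h (free_rep m \<beta>) Y"
  have gh: "is_hom g X Y" using g by (simp add: is_epi_def)
  have "\<exists>\<xi>. \<xi> \<in> spc X (\<beta> n) \<and> g (\<beta> n) \<xi> = h (\<beta> n) (unit_fun n)" if "n < m" for n
  proof -
    have "h (\<beta> n) (unit_fun n) \<in> spc Y (\<beta> n)"
      by (rule hom_closed[OF h unit_fun_free[OF that order_refl]])
    then have "h (\<beta> n) (unit_fun n) \<in> g (\<beta> n) ` spc X (\<beta> n)" using g by (simp add: is_epi_def)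
    then show ?thesis by auto
  qed
  then obtain \<xi> where \<xi>: "\<And>n. n < m \<Longrightarrow> \<xi> n \<in> spc X (\<beta> n)"
    "\<And>n. n < m \<Longrightarrow> g (\<beta> n) (\<xi> n) = h (\<beta> n) (unit_fun n)" by metis
  have l: "is_hom (free_map X m \<beta> \<xi>) (free_rep m \<beta>) X" by (rule free_map_hom[OF X \<xi>(1)])
  show "\<exists>l. is_hom l (free_rep m \<beta>) X \<and> (\<forall>x. \<forall>v\<in>spc (free_rep m \<beta>) x. g x (l x v) = h x v)"
  proof (intro exI conjI allI ballI)
    show "is_hom (free_map X m \<beta> \<xi>) (free_rep m \<beta>) X" by fact
    show "g x (free_map X m \<beta> \<xi> x v) = h x v" if "v \<in> spc (free_rep m \<beta>) x" for x v
      by (rule free_hom_eqI[OF Y hom_comp[OF l gh] h _ that])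
        (simp add: free_map_unit[OF X] act_id[OF X] \<xi>)
  qed
qed (rule free_mod)

lemma cofree_map_hom:
  assumes N: "is_mod N"
    and \<psi>: "\<And>n. n < m \<Longrightarrow> linear_between (scal N) (spc N (\<beta> n)) (*) UNIV (\<psi> n)"
  shows "is_hom (cofree_map N m \<beta> \<psi>) N (cofree_rep m \<beta>)"
proof (rule homI)
  have add: "\<psi> n (u + v) = \<psi> n u + \<psi> n v"
    if "n < m" "u \<in> spc N (\<beta> n)" "v \<in> spc N (\<beta> n)" for n u v
    using \<psi>[OF that(1)] that by (auto simp: linear_between_def)
  have sc: "\<psi> n (scal N c v) = c * \<psi> n v"
    if "n < m" "v \<in> spc N (\<beta> n)" for n v c
    using \<psi>[OF that(1)] that by (auto simp: linear_between_def)
  show "cofree_map N m \<beta> \<psi> x v \<in> spc (cofree_rep m \<beta>) x" for x v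
    by (simp add: cofree_map_def cofree_rep_def)
  show "cofree_map N m \<beta> \<psi> x (u + v) = cofree_map N m \<beta> \<psi> x u + cofree_map N m \<beta> \<psi> x v"
    if "u \<in> spc N x" "v \<in> spc N x" for x u v
    using that by (auto simp: cofree_map_def fun_eq_iff act_add[OF N] add act_closed[OF N])
  show "cofree_map N m \<beta> \<psi> x (scal N c v) = scal (cofree_rep m \<beta>) c (cofree_map N m \<beta> \<psi> x v)"
    if "v \<in> spc N x" for x c v
    using that by (auto simp: cofree_map_def cofree_rep_def fscal_def fun_eq_iff act_scal[OF N] sc act_closed[OF N])
  show "cofree_map N m \<beta> \<psi> y (act N x y v) = act (cofree_rep m \<beta>) x y (cofree_map N m \<beta> \<psi> x v)"
    if "x \<le> y" "v \<in> spc N x" for x y v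
    using that order_trans[OF that(1)]
    by (auto simp: cofree_map_def cofree_rep_def fun_eq_iff act_act[OF N])
qed

text \<open>The structure map from \<open>z\<close> to \<open>\<beta> n\<close> keeps the
  \<open>n\<close>-th coordinate, so this coordinate can be read off at \<open>\<beta> n\<close>: a
  morphism is determined by the functionals \<open>\<lambda>w. h (\<beta> n) w n\<close>.\<close>

lemma cofree_hom_nth:
  assumes h: "is_hom h N (cofree_rep m \<beta>)" and v: "v \<in> spc N z"
  shows "h z v = cofree_map N m \<beta> (\<lambda>n w. h (\<beta> n) w n) z v"
proof
  fix n
  show "h z v n = cofree_map N m \<beta> (\<lambda>n w. h (\<beta> n) w n) z v n"
  proof (cases "n < m \<and> z \<le> \<beta> n")
    case True
    then have "h (\<beta> n) (act N z (\<beta> n) v) = act (cofree_rep m \<beta>) z (\<beta> n) (h z v)"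
      using hom_act[OF h _ v] by blast
    with True show ?thesis by (simp add: cofree_map_def cofree_rep_def)
  next
    case False
    then show ?thesis using hom_closed[OF h v] by (auto simp: cofree_map_def cofree_rep_def)
  qed
qed

text \<open>The functionals describing \<open>h\<close> at the vertices \<open>\<beta> n\<close> are
  extended along \<open>g\<close>, one vector space at a time, and the extended functionals define
  the extension of \<open>h\<close>.\<close>

lemma cofree_injective: "injective (cofree_rep m \<beta> :: ('p::{finite,order}, 'k::field) urep)"
  unfolding injective_def
proof (intro conjI allI impI)
  fix X Y :: "('p, 'k) urep" and g h
  assume X: "is_mod X" and Y: "is_mod Y" and g: "is_mono g X Y"
    and h: "is_hom h X (cofree_rep m \<beta>)"
  have gh: "is_hom g X Y" and inj: "inj_on (g x) (spc X x)" for x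
    using g by (simp_all add: is_mono_def)
  have "\<exists>\<psi>. linear_between (scal Y) UNIV (*) UNIV \<psi> \<and>
      (\<forall>w\<in>spc X (\<beta> n). \<psi> (g (\<beta> n) w) = h (\<beta> n) w n)" for n
  proof -
    have "linear_between (scal X) (spc X (\<beta> n)) (*) UNIV (\<lambda>w. h (\<beta> n) w n)"
      using hom_add[OF h, of _ "\<beta> n"] hom_scal[OF h, of _ "\<beta> n"]
      by (simp add: linear_between_def cofree_rep_def fscal_def)
    from extend_functional_along_inj[OF mod_vector_space[OF X] mod_vector_space[OF Y]
        mod_subspace[OF X] hom_linear[OF gh] inj this]
    show ?thesis by metis
  qed
  then obtain \<psi> where \<psi>: "\<And>n. linear_between (scal Y) UNIV (*) UNIV (\<psi> n)"
    "\<And>n w. w \<in> spc X (\<beta> n) \<Longrightarrow> \<psi> n (g (\<beta> n) w) = h (\<beta> n) w n" by metis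
  show "\<exists>l. is_hom l Y (cofree_rep m \<beta>) \<and> (\<forall>x. \<forall>v\<in>spc X x. l x (g x v) = h x v)"
  proof (intro exI conjI allI ballI)
    show "is_hom (cofree_map Y m \<beta> \<psi>) Y (cofree_rep m \<beta>)"
      using \<psi>(1) by (intro cofree_map_hom[OF Y]) (auto simp: linear_between_def)
    show "cofree_map Y m \<beta> \<psi> x (g x v) = h x v" if "v \<in> spc X x" for x v
      unfolding cofree_hom_nth[OF h that]
      by (auto simp: cofree_map_def fun_eq_iff hom_act[OF gh _ that, symmetric] \<psi>(2) act_closed[OF X _ that])
  qed
qed (rule cofree_mod)


section \<open>Existence of minimal resolutions\<close>

lemma finite_order_less_induct:
  fixes z :: "'p::{finite,order}"
  assumes "\<And>z. (\<And>y. y < z \<Longrightarrow> P y) \<Longrightarrow> P z"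
  shows "P z"
proof (induction z rule: measure_induct_rule[of "\<lambda>z. card {..<z}"])
  case (less z)
  have "card {..<y} < card {..<z}" if "y < z" for y
    using that by (intro psubset_card_mono) auto
  with less assms show ?case by blast
qed

lemma finite_order_greater_induct:
  fixes z :: "'p::{finite,order}"
  assumes "\<And>z. (\<And>y. z < y \<Longrightarrow> P y) \<Longrightarrow> P z"
  shows "P z"
proof (induction z rule: measure_induct_rule[of "\<lambda>z. card {z<..}"])
  case (less z)
  have "card {y<..} < card {z<..}" if "z < y" for y
    using that by (intro psubset_card_mono) auto
  with less assms show ?case by blast
qed

text \<open>The terms of a resolution consist of functions on the natural numbers, so the generators
  at all vertices are numbered by one sequence: \<open>\<beta> n\<close> is the vertex of the
  \<open>n\<close>-th generator and \<open>b n\<close> its vector. The last clause excludes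
  repetitions, so that duality relations can be read off on indices.\<close>

lemma finite_family_enumeration:
  fixes T :: "'p::finite \<Rightarrow> 'v set"
  assumes "\<And>z. finite (T z)"
  shows "\<exists>(m::nat) \<beta> b. (\<forall>n<m. b n \<in> T (\<beta> n)) \<and> (\<forall>z. \<forall>t\<in>T z. \<exists>n<m. \<beta> n = z \<and> b n = t) \<and>
    (\<forall>i<m. \<forall>j<m. \<beta> i = \<beta> j \<longrightarrow> b i = b j \<longrightarrow> i = j)"
proof -
  have "finite (Sigma UNIV T)" using assms by simp
  from ex_bij_betw_nat_finite[OF this] obtain h m where h: "bij_betw h {0..<m::nat} (Sigma UNIV T)"
    by blast
  show ?thesis
  proof (rule exI[of _ m], rule exI[of _ "\<lambda>n. fst (h n)"], rule exI[of _ "\<lambda>n. snd (h n)"],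
      intro conjI allI ballI impI)
    show "snd (h n) \<in> T (fst (h n))" if "n < m" for n
      using bij_betwE[OF h] that by (force simp: Sigma_def)
    show "\<exists>n<m. fst (h n) = z \<and> snd (h n) = t" if t: "t \<in> T z" for z t
    proof -
      have "(z, t) \<in> h ` {0..<m}" using h t by (auto simp: bij_betw_def)
      then obtain n where "n < m" "h n = (z, t)" by auto
      then show ?thesis by force
    qed
    show "i = j" if "i < m" "j < m" "fst (h i) = fst (h j)" "snd (h i) = snd (h j)" for i j
      using bij_betw_imp_inj_on[OF h] that by (auto simp: inj_on_def prod_eq_iff)
  qed
qed

text \<open>The cover is freely generated by bases of complements of \<open>R z\<close>, the value at \<open>z\<close> of the
  radical, so its kernel only involves generators strictly below \<open>z\<close>.\<close>

lemma projective_cover_exists: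
  fixes N :: "('p::{finite,order}, 'k::field, 'v::ab_group_add) rep"
  assumes N: "is_mod N"
  obtains P f where "projective_cover f P N"
proof -
  interpret vector_space "scal N" using N by (rule mod_vector_space)
  \<comment> \<open>Every non-identity arrow into \<open>z\<close> starts at a strictly smaller
    vertex, so these images span the radical at \<open>z\<close>.\<close>
  define G where "G z = (\<Union>y\<in>{y. y < z}. act N y z ` spc N y)" for z
  define R where "R z = span (G z)" for z
  have RN: "R z \<subseteq> spc N z" for z
    unfolding R_def G_def
    by (rule span_minimal[OF _ mod_subspace[OF N]]) (auto intro: act_closed[OF N])
  have "\<exists>T \<phi>. relative_dual_basis (scal N) (R z) (spc N z) T \<phi>" for z
  proof -
    obtain B where B: "finite B" "spc N z = span B" using mod_finite_span[OF N] by blast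
    have "subspace (R z)" by (simp add: R_def)
    then show ?thesis by (rule relative_dual_basis_exists[OF vector_space_axioms _ RN B])
  qed
  then obtain T \<phi> where T\<phi>: "\<And>z. relative_dual_basis (scal N) (R z) (spc N z) (T z) (\<phi> z)"
    by metis
  have T: "finite (T z)" "T z \<subseteq> spc N z" for z
    using T\<phi>[of z] by (simp_all add: relative_dual_basis_def)
  have \<phi>: "t \<in> T z \<Longrightarrow> linear_between (scal N) UNIV (*) UNIV (\<phi> z t)"
      "t \<in> T z \<Longrightarrow> t' \<in> T z \<Longrightarrow> \<phi> z t t' = (if t = t' then 1 else 0)"
      "t \<in> T z \<Longrightarrow> u \<in> R z \<Longrightarrow> \<phi> z t u = 0"
      "v \<in> spc N z \<Longrightarrow> v - (\<Sum>t\<in>T z. scal N (\<phi> z t v) t) \<in> R z" for z t t' u v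
    using T\<phi>[of z] by (simp_all add: relative_dual_basis_def)
  obtain m :: nat and \<beta> b where b': "\<forall>n<m. b n \<in> T (\<beta> n)" "\<forall>z. \<forall>t\<in>T z. \<exists>n<m. \<beta> n = z \<and> b n = t"
      "\<forall>i<m. \<forall>j<m. \<beta> i = \<beta> j \<longrightarrow> b i = b j \<longrightarrow> i = j"
    using finite_family_enumeration[where T = T, OF T(1)] by (elim exE conjE, intro that)
  have b: "n < m \<Longrightarrow> b n \<in> T (\<beta> n)" "t \<in> T z \<Longrightarrow> \<exists>n<m. \<beta> n = z \<and> b n = t"
    "i < m \<Longrightarrow> j < m \<Longrightarrow> \<beta> i = \<beta> j \<Longrightarrow> b i = b j \<Longrightarrow> i = j" for n z t i j
    using b' by simp_all
  let ?F = "free_rep m \<beta> :: ('p, 'k) urep"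
  define f where "f = free_map N m \<beta> b"
  have F: "is_mod ?F" by (rule free_mod)
  have f: "is_hom f ?F N"
    unfolding f_def using b(1) T(2) by (intro free_map_hom[OF N]) blast
  \<comment> \<open>Nakayama's argument as an induction up the poset: \<open>R z\<close> is reached
    from smaller vertices, and the generators at \<open>z\<close> supply the complement basis
    \<open>T z\<close>.\<close>
  have im: "spc N z \<subseteq> f z ` spc ?F z" for z
  proof (induction z rule: finite_order_less_induct)
    case (1 z)
    have sub: "subspace (f z ` spc ?F z)"
      using im_sub[OF F N f sub_whole[OF F]] by (simp add: is_sub_def)
    have "G z \<subseteq> f z ` spc ?F z"
    proof
      fix v assume "v \<in> G z"
      then obtain y w where y: "y < z" "w \<in> spc N y" "v = act N y z w" by (auto simp: G_def)
      with 1 obtain p where p: "p \<in> spc ?F y" "w = f y p" by blast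
      have "f z (act ?F y z p) = v" using hom_act[OF f _ p(1)] p y by simp
      moreover have "act ?F y z p \<in> spc ?F z" using act_closed[OF F _ p(1)] y(1) by simp
      ultimately show "v \<in> f z ` spc ?F z" by blast
    qed
    then have R: "R z \<subseteq> f z ` spc ?F z" unfolding R_def by (rule span_minimal[OF _ sub])
    have Tz: "t \<in> f z ` spc ?F z" if t: "t \<in> T z" for t
    proof -
      obtain n where n: "n < m" "\<beta> n = z" "b n = t" using b(2)[OF t] by blast
      have "f z (unit_fun n) = t"
        using free_map_unit[OF N n(1), where \<beta> = \<beta> and z = z and b = b] n act_id[OF N, of t z] t T(2)[of z]
        by (auto simp: f_def)
      moreover have "unit_fun n \<in> spc ?F z" using n by (intro unit_fun_free) auto
      ultimately show ?thesis by blast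
    qed
    show ?case
    proof
      fix v assume v: "v \<in> spc N z"
      have "(\<Sum>t\<in>T z. scal N (\<phi> z t v) t) \<in> f z ` spc ?F z"
        by (intro subspace_sum[OF sub] subspace_scale[OF sub] Tz)
      moreover have "v - (\<Sum>t\<in>T z. scal N (\<phi> z t v) t) \<in> f z ` spc ?F z" using \<phi>(4)[OF v] R by blast
      ultimately have "(v - (\<Sum>t\<in>T z. scal N (\<phi> z t v) t)) + (\<Sum>t\<in>T z. scal N (\<phi> z t v) t) \<in> f z ` spc ?F z"
        by (intro subspace_add[OF sub])
      then show "v \<in> f z ` spc ?F z" by simp
    qed
  qed
  have epi: "is_epi f ?F N"
    unfolding is_epi_def using f im hom_closed[OF f] by blast
  \<comment> \<open>Apply the coordinate functional of \<open>b n\<close> to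
    \<open>f z p = 0\<close>: generators strictly below \<open>z\<close> land in \<open>R z\<close>,
    where it vanishes, and those at \<open>z\<close> are dual to it, so only \<open>p n\<close>
    remains.\<close>
  have ker: "p n = 0" if p: "p \<in> ker_of f ?F z" and n: "n < m" "\<beta> n = z" for p n z
  proof -
    have pF: "p \<in> spc ?F z" and fp: "f z p = 0" using p by (auto simp: ker_of_def)
    have bn: "b n \<in> T z" using b(1) n by blast
    let ?\<phi> = "\<phi> z (b n)"
    have lin: "?\<phi> (u + v) = ?\<phi> u + ?\<phi> v" "?\<phi> (scal N c v) = c * ?\<phi> v" for u v c
      using \<phi>(1)[OF bn] by (auto simp: linear_between_def)
    have z0: "?\<phi> 0 = 0" using lin(2)[of 0 0] by simp
    have \<phi>_sum: "?\<phi> (sum g J) = (\<Sum>i\<in>J. ?\<phi> (g i))" for g :: "nat \<Rightarrow> 'v" and J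
      by (induction J rule: infinite_finite_induct) (simp_all add: z0 lin)
    have "0 = ?\<phi> (f z p)" using fp z0 by simp
    also have "\<dots> = (\<Sum>i | i < m \<and> \<beta> i \<le> z. p i * ?\<phi> (act N (\<beta> i) z (b i)))"
      by (simp add: f_def free_map_def \<phi>_sum lin)
    also have "\<dots> = (\<Sum>i | i < m \<and> \<beta> i \<le> z. if i = n then p i else 0)"
    proof (rule sum.cong[OF refl])
      fix i assume i: "i \<in> {i. i < m \<and> \<beta> i \<le> z}"
      show "p i * ?\<phi> (act N (\<beta> i) z (b i)) = (if i = n then p i else 0)"
      proof (cases "\<beta> i = z")
        case True
        then have "b i \<in> T z" "b n = b i \<longleftrightarrow> i = n" using b(1,3) i n by auto
        moreover have "act N (\<beta> i) z (b i) = b i"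
          using True act_id[OF N, of "b i" z] T(2)[of z] calculation by auto
        ultimately show ?thesis using \<phi>(2)[OF bn] by auto
      next
        case False
        then have "\<beta> i < z" using i by (simp add: less_le)
        moreover have "b i \<in> spc N (\<beta> i)" using b(1) T(2) i by blast
        ultimately have "act N (\<beta> i) z (b i) \<in> R z"
          unfolding R_def G_def by (intro span_base) blast
        then show ?thesis using \<phi>(3)[OF bn] False n by auto
      qed
    qed
    also have "\<dots> = p n" using n by simp
    finally show ?thesis by simp
  qed
  have "superfluous (ker_of f ?F) ?F"
    unfolding superfluous_def
  proof (intro conjI allI impI)
    show K: "is_sub (ker_of f ?F) ?F" by (rule ker_sub[OF F N f])
    fix W assume W: "is_sub W ?F" and sum: "sub_sum (ker_of f ?F) W = spc ?F"
    \<comment> \<open>By induction \<open>W\<close> contains all generators strictly below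
      \<open>z\<close>, hence the kernel at \<open>z\<close>; since the kernel and \<open>W\<close>
      together fill the space, \<open>W\<close> does so alone.\<close>
    have "spc ?F z \<subseteq> W z" for z
    proof (induction z rule: finite_order_less_induct)
      case (1 z)
      have kerW: "u \<in> W z" if u: "u \<in> ker_of f ?F z" for u
      proof -
        have uF: "u \<in> spc ?F z" using u by (simp add: ker_of_def)
        have "fscal (u n) (unit_fun n) \<in> W z" if n: "n < m" "\<beta> n \<le> z" for n
        proof (cases "\<beta> n = z")
          case True
          then have "fscal (u n) (unit_fun n) = 0" using ker[OF u n(1)] by (simp add: fscal_def fun_eq_iff)
          then show ?thesis using sub_zero_mem[OF F W] by simp
        next
          case False
          then have lt: "\<beta> n < z" using n by (simp add: less_le)
          have "unit_fun n \<in> W (\<beta> n)" using 1[OF lt] unit_fun_free[OF n(1), of \<beta> "\<beta> n"] by auto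
          then have "act ?F (\<beta> n) z (unit_fun n) \<in> W z" using sub_act[OF W n(2)] by blast
          then have "scal ?F (u n) (act ?F (\<beta> n) z (unit_fun n)) \<in> W z" by (rule sub_scal[OF F W])
          then show ?thesis by (simp add: free_rep_def)
        qed
        then have "(\<Sum>n | n < m \<and> \<beta> n \<le> z. fscal (u n) (unit_fun n)) \<in> W z"
          by (intro sub_sum_closed[OF F W]) auto
        then show ?thesis by (simp add: free_decomp[OF uF])
      qed
      show ?case
      proof
        fix p assume "p \<in> spc ?F z"
        then have "p \<in> sub_sum (ker_of f ?F) W z" using sum by simp
        then obtain u w where "u \<in> ker_of f ?F z" "w \<in> W z" "p = u + w"
          by (auto simp: sub_sum_def)
        then show "p \<in> W z" using sub_add[OF F W] kerW by blast
      qed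
    qed
    then have "W z = spc ?F z" for z using sub_subset[OF W, of _ z] by blast
    then show "W = spc ?F" by (rule ext)
  qed
  then have "projective_cover f ?F N" using free_projective epi by (simp add: projective_cover_def)
  then show thesis using that by blast
qed

text \<open>Applied to \<open>U = 0\<close> this is an injective envelope of \<open>X\<close>, in general one of \<open>X / U\<close>. It is
  cogenerated by dual bases of \<open>S z / U z\<close>, the value at \<open>z\<close> of the socle of \<open>X / U\<close>.\<close>

lemma quotient_injective_envelope_exists:
  fixes X :: "('p::{finite,order}, 'k::field, 'v::ab_group_add) rep"
  assumes X: "is_mod X" and U: "is_sub U X"
  obtains Q d where "injective Q" "is_hom d X Q" "ker_of d X = U" "essential (im_of d X) Q"
proof -
  interpret vector_space "scal X" using X by (rule mod_vector_space)
  define S where "S z = {v \<in> spc X z. \<forall>y>z. act X z y v \<in> U y}" for z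
  have US: "U z \<subseteq> S z" for z
    using sub_subset[OF U] sub_act[OF U] by (auto simp: S_def)
  have SX: "S z \<subseteq> spc X z" for z by (auto simp: S_def)
  have subS: "subspace (S z)" for z
    by (rule subspaceI)
      (auto simp: S_def mod_zero[OF X] mod_add_closed[OF X] mod_scal_closed[OF X] act_zero[OF X]
        act_add[OF X] act_scal[OF X] sub_zero_mem[OF X U] sub_add[OF X U] sub_scal[OF X U])
  have "\<exists>T \<phi>. relative_dual_basis (scal X) (U z) (S z) T \<phi>" for z
  proof -
    obtain B where B: "finite B" "spc X z = span B" using mod_finite_span[OF X] by blast
    obtain C where C: "finite C" "S z = span C"
      using subspace_finite_span[OF vector_space_axioms B(1) _ subS] SX B(2) by metis
    have "subspace (U z)" using U by (simp add: is_sub_def)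
    then show ?thesis by (rule relative_dual_basis_exists[OF vector_space_axioms _ US C])
  qed
  then obtain T \<phi> where T\<phi>: "\<And>z. relative_dual_basis (scal X) (U z) (S z) (T z) (\<phi> z)"
    by metis
  have T: "finite (T z)" "T z \<subseteq> S z" for z
    using T\<phi>[of z] by (simp_all add: relative_dual_basis_def)
  have \<phi>: "t \<in> T z \<Longrightarrow> linear_between (scal X) UNIV (*) UNIV (\<phi> z t)"
      "t \<in> T z \<Longrightarrow> t' \<in> T z \<Longrightarrow> \<phi> z t t' = (if t = t' then 1 else 0)"
      "t \<in> T z \<Longrightarrow> u \<in> U z \<Longrightarrow> \<phi> z t u = 0"
      "v \<in> S z \<Longrightarrow> v - (\<Sum>t\<in>T z. scal X (\<phi> z t v) t) \<in> U z" for z t t' u v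
    using T\<phi>[of z] by (simp_all add: relative_dual_basis_def)
  obtain m :: nat and \<beta> b where b': "\<forall>n<m. b n \<in> T (\<beta> n)" "\<forall>z. \<forall>t\<in>T z. \<exists>n<m. \<beta> n = z \<and> b n = t"
      "\<forall>i<m. \<forall>j<m. \<beta> i = \<beta> j \<longrightarrow> b i = b j \<longrightarrow> i = j"
    using finite_family_enumeration[where T = T, OF T(1)] by (elim exE conjE, intro that)
  have b: "n < m \<Longrightarrow> b n \<in> T (\<beta> n)" "t \<in> T z \<Longrightarrow> \<exists>n<m. \<beta> n = z \<and> b n = t"
    "i < m \<Longrightarrow> j < m \<Longrightarrow> \<beta> i = \<beta> j \<Longrightarrow> b i = b j \<Longrightarrow> i = j" for n z t i j
    using b' by simp_all
  let ?Q = "cofree_rep m \<beta> :: ('p, 'k) urep"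
  define \<psi> where "\<psi> n = \<phi> (\<beta> n) (b n)" for n
  define d where "d = cofree_map X m \<beta> \<psi>"
  have Q: "is_mod ?Q" by (rule cofree_mod)
  have lin: "linear_between (scal X) UNIV (*) UNIV (\<psi> n)" if "n < m" for n
    using \<phi>(1) b(1)[OF that] by (simp add: \<psi>_def)
  have \<psi>_add: "\<psi> n (u + v) = \<psi> n u + \<psi> n v" and \<psi>_scal: "\<psi> n (scal X c v) = c * \<psi> n v"
    if "n < m" for n u v c using lin[OF that] by (auto simp: linear_between_def)
  have \<psi>_zero: "\<psi> n 0 = 0" if "n < m" for n using \<psi>_scal[OF that, of 0 0] by simp
  have \<psi>_sum: "\<psi> n (sum g J) = (\<Sum>i\<in>J. \<psi> n (g i))" if "n < m" for n J and g :: "nat \<Rightarrow> 'v"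
    by (induction J rule: infinite_finite_induct) (simp_all add: \<psi>_zero \<psi>_add that)
  have \<psi>_U: "\<psi> n u = 0" if "n < m" "u \<in> U (\<beta> n)" for n u
    using \<phi>(3) b(1) that by (simp add: \<psi>_def)
  have d: "is_hom d X ?Q"
    unfolding d_def using lin by (intro cofree_map_hom[OF X]) (auto simp: linear_between_def)
  have "U z \<subseteq> ker_of d X z" for z
    using sub_subset[OF U] sub_act[OF U] \<psi>_U
    by (auto simp: ker_of_def d_def cofree_map_def fun_eq_iff)
  \<comment> \<open>Induction down the poset: the images of \<open>v\<close> at larger vertices lie
    in the kernel, hence in \<open>U\<close>, so \<open>v\<close> lies in \<open>S z\<close>, where
    the coordinates \<open>\<phi> z t\<close> detect it modulo \<open>U z\<close>. These are the
    coordinates of \<open>d z v\<close> with \<open>\<beta> n = z\<close>.\<close>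
  moreover have "ker_of d X z \<subseteq> U z" for z
  proof (induction z rule: finite_order_greater_induct)
    case (1 z)
    show ?case
    proof
      fix v assume v: "v \<in> ker_of d X z"
      then have vX: "v \<in> spc X z" and dv: "d z v = 0" by (auto simp: ker_of_def)
      have "act X z y v \<in> U y" if y: "z < y" for y
        using 1[OF y] sub_act[OF ker_sub[OF X Q d], of z y v] v y by auto
      then have vS: "v \<in> S z" using vX by (simp add: S_def)
      have "\<phi> z t v = 0" if t: "t \<in> T z" for t
      proof -
        obtain n where n: "n < m" "\<beta> n = z" "b n = t" using b(2)[OF t] by blast
        have "d z v n = 0" using dv by simp
        then show ?thesis using n act_id[OF X vX] by (simp add: d_def cofree_map_def \<psi>_def)
      qed
      then show "v \<in> U z" using \<phi>(4)[OF vS] by simp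
    qed
  qed
  ultimately have ker: "ker_of d X = U" by (intro ext equalityI)
  have "essential (im_of d X) ?Q"
    unfolding essential_def
  proof (intro conjI allI impI)
    show "is_sub (im_of d X) ?Q" by (rule im_of_sub[OF X Q d])
    fix W assume W: "is_sub W ?Q" and int: "sub_Int (im_of d X) W = sub_zero"
    have "W z \<subseteq> {0}" for z
    proof (induction z rule: finite_order_greater_induct)
      case (1 z)
      have "w = 0" if w: "w \<in> W z" for w
      proof -
        have wQ: "w \<in> spc ?Q z" by (rule sub_subset[OF W w])
        \<comment> \<open>The structure map to \<open>\<beta> n\<close> keeps the
          \<open>n\<close>-th coordinate and lands in \<open>W (\<beta> n)\<close>, which is zero by
          induction; thus \<open>w\<close> is supported on generators at \<open>z\<close>
          itself.\<close>
        have above: "w n = 0" if n: "z < \<beta> n" for n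
        proof -
          have "act ?Q z (\<beta> n) w \<in> W (\<beta> n)" using sub_act[OF W _ w] n by simp
          then have "act ?Q z (\<beta> n) w = 0" using 1[OF n] by blast
          then have "act ?Q z (\<beta> n) w n = 0" by simp
          then show ?thesis by (simp add: cofree_rep_def)
        qed
        \<comment> \<open>A preimage of \<open>w\<close> under \<open>d\<close>: its coefficients
          are put on the complement basis \<open>T z\<close>. Membership in \<open>S z\<close> makes
          the coordinates of \<open>d z v\<close> at vertices strictly above \<open>z\<close>
          vanish.\<close>
        define v where "v = (\<Sum>n | n < m \<and> \<beta> n = z. scal X (w n) (b n))"
        have vS: "v \<in> S z"
          unfolding v_def using b(1) T(2)
          by (intro subspace_sum[OF subS] subspace_scale[OF subS]) auto
        have "d z v n = w n" for n
        proof -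
          consider "n < m" "\<beta> n = z" | "n < m" "z < \<beta> n" | "\<not> (n < m \<and> z \<le> \<beta> n)" by fastforce
          then show ?thesis
          proof cases
            case 1
            have "d z v n = \<psi> n v"
              using 1 vS SX[of z] act_id[OF X, of v z] by (auto simp: d_def cofree_map_def)
            also have "\<dots> = (\<Sum>i | i < m \<and> \<beta> i = z. w i * \<psi> n (b i))"
              unfolding v_def by (simp add: \<psi>_sum[OF 1(1)] \<psi>_scal[OF 1(1)])
            also have "\<dots> = (\<Sum>i | i < m \<and> \<beta> i = z. if i = n then w i else 0)"
            proof (rule sum.cong[OF refl])
              fix i assume i: "i \<in> {i. i < m \<and> \<beta> i = z}"
              then have "b n \<in> T z" "b i \<in> T z" "b n = b i \<longleftrightarrow> i = n"
                using b(1)[of i] b(1)[of n] b(3)[of n i] 1 by auto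
              then have "\<psi> n (b i) = (if i = n then 1 else 0)" using 1 \<phi>(2) by (simp add: \<psi>_def)
              then show "w i * \<psi> n (b i) = (if i = n then w i else 0)" by simp
            qed
            also have "\<dots> = w n" using 1 by simp
            finally show ?thesis .
          next
            case 2
            then have "act X z (\<beta> n) v \<in> U (\<beta> n)" using vS by (simp add: S_def)
            then show ?thesis using 2 above \<psi>_U by (simp add: d_def cofree_map_def)
          next
            case 3
            then show ?thesis using wQ by (auto simp: d_def cofree_map_def cofree_rep_def)
          qed
        qed
        then have "w = d z v" by auto
        then have "w \<in> sub_Int (im_of d X) W z"
          using w vS SX by (auto simp: sub_Int_def im_of_def)
        then show ?thesis using int by (simp add: sub_zero_def)
      qed
      then show ?case by blast
    qed
    then have "W z = {0}" for z using sub_zero_mem[OF Q W] by blast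
    then show "W = sub_zero" unfolding sub_zero_def by (rule ext)
  qed
  with cofree_injective d ker show thesis by (rule that)
qed

section \<open>Splicing covers and envelopes into minimal resolutions\<close>

lemma minimal_projective_resolution_exists:
  fixes N :: "('p::{finite,order}, 'k::field, 'v::ab_group_add) rep"
  assumes N: "is_mod N"
  obtains P d e where "minimal_projective_resolution N P d e"
proof -
  obtain P0 e where P0: "projective_cover e P0 N" using projective_cover_exists[OF N] by blast
  have mP0: "is_mod P0" and he: "is_hom e P0 N"
    using P0 by (auto simp: projective_cover_def projective_def is_epi_def)
  \<comment> \<open>A state is a term together with the syzygy inside it that is covered next. The
    clause for \<open>n = 0\<close> pins the start, which dependent choice would otherwise leave
    open.\<close>
  define good where "good n S \<longleftrightarrow> is_mod (fst S) \<and> is_sub (snd S) (fst S) \<and>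
    (n = (0::nat) \<longrightarrow> S = (P0, ker_of e P0))" for n and S :: "('p, 'k) urep \<times> ('p \<Rightarrow> (nat \<Rightarrow> 'k) set)"
  define next_of where "next_of S S' \<longleftrightarrow>
    (\<exists>d. projective_cover d (fst S') (sub_of (fst S) (snd S)) \<and> snd S' = ker_of d (fst S'))"
    for S S' :: "('p, 'k) urep \<times> ('p \<Rightarrow> (nat \<Rightarrow> 'k) set)"
  have base: "\<exists>S. good 0 S"
    using mP0 ker_sub[OF mP0 N he] by (auto simp: good_def)
  have step: "\<exists>S'. good (Suc n) S' \<and> next_of S S'" if S: "good n S" for n S
  proof -
    have M: "is_mod (sub_of (fst S) (snd S))" using S by (simp add: good_def sub_mod)
    obtain P' d where d: "projective_cover d P' (sub_of (fst S) (snd S))"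
      using projective_cover_exists[OF M] by blast
    then have "is_mod P'" "is_hom d P' (sub_of (fst S) (snd S))"
      by (auto simp: projective_cover_def projective_def is_epi_def)
    with d M show ?thesis
      by (intro exI[of _ "(P', ker_of d P')"]) (auto simp: good_def next_of_def intro: ker_sub)
  qed
  obtain S where S: "\<And>n. good n (S n)" "\<And>n. next_of (S n) (S (Suc n))"
    using dependent_nat_choice[where P = good and Q = "\<lambda>_. next_of", OF base] step by metis
  define P where "P n = fst (S n)" for n
  define K where "K n = snd (S n)" for n
  have mP: "is_mod (P n)" and sK: "is_sub (K n) (P n)" for n
    using S(1)[of n] by (auto simp: good_def P_def K_def)
  have P_0: "P 0 = P0" "K 0 = ker_of e P0" using S(1)[of 0] by (auto simp: good_def P_def K_def)
  obtain d where d: "\<And>n. projective_cover (d n) (P (Suc n)) (sub_of (P n) (K n))"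
    "\<And>n. K (Suc n) = ker_of (d n) (P (Suc n))"
    using S(2) unfolding next_of_def P_def K_def by metis
  have im: "im_of (d n) (P (Suc n)) = K n" for n
    using d(1)[of n] by (auto simp: projective_cover_def is_epi_def im_of_def)
  have hd: "is_hom (d n) (P (Suc n)) (P n)" for n
    using d(1)[of n] hom_extend_codomain[OF _ sK] by (auto simp: projective_cover_def is_epi_def)
  have pr: "projective (P n)" for n
    using P0 d(1) P_0 by (cases n) (auto simp: projective_cover_def)
  have "projective_resolution N P d e"
    using pr hd im P0 P_0 d(2) by (simp add: projective_resolution_def projective_cover_def)
  then have "minimal_projective_resolution N P d e"
    using P0 P_0 d(1) im by (simp add: minimal_projective_resolution_def)
  then show thesis by (rule that)
qed

lemma mono_of_trivial_kernel:
  assumes "is_mod M" "is_mod N" "is_hom f M N" "\<And>x. ker_of f M x \<subseteq> {0}"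
  shows "is_mono f M N"
  using assms hom_inj_iff[OF assms(1-3)] by (auto simp: is_mono_def ker_of_def)

lemma injective_envelope_exists:
  fixes N :: "('p::{finite,order}, 'k::field, 'v::ab_group_add) rep"
  assumes N: "is_mod N"
  obtains Q e where "injective_envelope e N Q"
proof -
  obtain Q e where Q: "injective Q" "is_hom e N Q" "ker_of e N = (\<lambda>x. {0})" "essential (im_of e N) Q"
    using quotient_injective_envelope_exists[OF N sub_null[OF N]] by blast
  then have "is_mono e N Q"
    using mono_of_trivial_kernel[OF N _ Q(2)] by (simp add: injective_def)
  with Q show thesis using that by (simp add: injective_envelope_def)
qed

lemma inclusion_mono:
  assumes "is_sub U M"
  shows "is_mono (\<lambda>x v. v) (sub_of M U) M"
  unfolding is_mono_def using sub_subset[OF assms] by (auto intro!: homI)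

lemma minimal_injective_coresolution_exists:
  fixes N :: "('p::{finite,order}, 'k::field, 'v::ab_group_add) rep"
  assumes N: "is_mod N"
  obtains Q d e where "minimal_injective_coresolution N Q d e"
proof -
  obtain Q0 e where Q0: "injective_envelope e N Q0" using injective_envelope_exists[OF N] by blast
  have mQ0: "is_mod Q0" and he: "is_hom e N Q0"
    using Q0 by (auto simp: injective_envelope_def injective_def is_mono_def)
  \<comment> \<open>A state is a term with the subrepresentation to be divided out. The envelope of
    the quotient is recorded by a map \<open>d\<close> with that kernel and with essential
    image.\<close>
  define good where "good n S \<longleftrightarrow> injective (fst S) \<and> is_sub (snd S) (fst S) \<and>
    (n = (0::nat) \<longrightarrow> S = (Q0, im_of e N))" for n and S :: "('p, 'k) urep \<times> ('p \<Rightarrow> (nat \<Rightarrow> 'k) set)"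
  define next_of where "next_of S S' \<longleftrightarrow>
    (\<exists>d. is_hom d (fst S) (fst S') \<and> ker_of d (fst S) = snd S \<and> im_of d (fst S) = snd S' \<and>
      essential (snd S') (fst S'))"
    for S S' :: "('p, 'k) urep \<times> ('p \<Rightarrow> (nat \<Rightarrow> 'k) set)"
  have base: "\<exists>S. good 0 S"
    using Q0 im_of_sub[OF N mQ0 he] by (auto simp: good_def injective_envelope_def)
  have step: "\<exists>S'. good (Suc n) S' \<and> next_of S S'" if S: "good n S" for n S
  proof -
    have M: "is_mod (fst S)" "is_sub (snd S) (fst S)" using S by (auto simp: good_def injective_def)
    obtain Q' d where d: "injective Q'" "is_hom d (fst S) Q'" "ker_of d (fst S) = snd S"
      "essential (im_of d (fst S)) Q'"
      using quotient_injective_envelope_exists[OF M] by blast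
    then show ?thesis
      by (intro exI[of _ "(Q', im_of d (fst S))"]) (auto simp: good_def next_of_def essential_def)
  qed
  obtain S where S: "\<And>n. good n (S n)" "\<And>n. next_of (S n) (S (Suc n))"
    using dependent_nat_choice[where P = good and Q = "\<lambda>_. next_of", OF base] step by metis
  define Q where "Q n = fst (S n)" for n
  define V where "V n = snd (S n)" for n
  have inj: "injective (Q n)" and sV: "is_sub (V n) (Q n)" for n
    using S(1)[of n] by (auto simp: good_def Q_def V_def)
  have Q_0: "Q 0 = Q0" "V 0 = im_of e N" using S(1)[of 0] by (auto simp: good_def Q_def V_def)
  obtain d where d: "\<And>n. is_hom (d n) (Q n) (Q (Suc n))" "\<And>n. ker_of (d n) (Q n) = V n"
    "\<And>n. im_of (d n) (Q n) = V (Suc n)" "\<And>n. essential (V (Suc n)) (Q (Suc n))"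
    using S(2) unfolding next_of_def Q_def V_def by metis
  have "injective_coresolution N Q d e"
    using inj d d(2)[of 0] Q0 Q_0 by (simp add: injective_coresolution_def injective_envelope_def)
  moreover have "injective_envelope (\<lambda>x v. v) (sub_of (Q (Suc n)) (V (Suc n))) (Q (Suc n))" for n
    using inj d(4) inclusion_mono[OF sV] by (simp add: injective_envelope_def im_of_def)
  ultimately have "minimal_injective_coresolution N Q d e"
    using Q0 Q_0 d(3) by (simp add: minimal_injective_coresolution_def)
  then show thesis by (rule that)
qed


section \<open>Lifting to projective covers and injective envelopes\<close>

text \<open>By definition, projectivity and injectivity are only tested on the universe \<open>urep\<close>. An
  arbitrary ambient space is reduced to it by embedding into an injective envelope, resp. by
  replacing the source of a monomorphism by its image.\<close>

lemma projective_lift: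
  fixes X :: "('p::{finite,order}, 'k::field) urep" and Y :: "('p, 'k, 'v::ab_group_add) rep"
  assumes P: "projective P" and X: "is_mod X" and Y: "is_mod Y"
    and g: "is_epi g X Y" and h: "is_hom h P Y"
  obtains l where "is_hom l P X" "\<And>x v. v \<in> spc P x \<Longrightarrow> g x (l x v) = h x v"
proof -
  obtain Q e where "injective_envelope e Y Q" using injective_envelope_exists[OF Y] by blast
  then have Q: "is_mod Q" and e: "is_hom e Y Q" and inj: "\<And>x. inj_on (e x) (spc Y x)"
    by (auto simp: injective_envelope_def injective_def is_mono_def)
  let ?Y = "sub_of Q (im_of e Y)"
  have gh: "is_hom g X Y" and gs: "\<And>x. g x ` spc X x = spc Y x" using g by (auto simp: is_epi_def)
  have e': "is_hom e Y ?Y" using epi_onto_image[OF e] by (simp add: is_epi_def)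
  have "is_mod ?Y" by (rule sub_mod[OF Q im_of_sub[OF Y Q e]])
  moreover have "is_epi (\<lambda>x v. e x (g x v)) X ?Y"
    unfolding is_epi_def using hom_comp[OF gh e'] gs by (simp add: im_of_def flip: image_image)
  ultimately obtain l where l: "is_hom l P X"
      "\<And>x v. v \<in> spc P x \<Longrightarrow> e x (g x (l x v)) = e x (h x v)"
    using P X hom_comp[OF h e'] unfolding projective_def by blast
  have "g x (l x v) = h x v" if "v \<in> spc P x" for x v
    using l(2)[OF that] inj_onD[OF inj] hom_closed[OF gh hom_closed[OF l(1) that]] hom_closed[OF h that]
    by blast
  with l(1) show thesis by (rule that)
qed

lemma injective_extend:
  fixes Y :: "('p::{finite,order}, 'k::field) urep" and X :: "('p, 'k, 'v::ab_group_add) rep"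
  assumes Q: "injective Q" and X: "is_mod X" and Y: "is_mod Y"
    and g: "is_mono g X Y" and h: "is_hom h X Q"
  obtains l where "is_hom l Y Q" "\<And>x v. v \<in> spc X x \<Longrightarrow> l x (g x v) = h x v"
proof -
  have gh: "is_hom g X Y" using g by (simp add: is_mono_def)
  let ?X = "sub_of Y (im_of g X)"
  have U: "is_sub (im_of g X) Y" by (rule im_of_sub[OF X Y gh])
  have epi: "is_epi g X ?X" by (rule epi_onto_image[OF gh])
  then have mono: "is_mono g X ?X" using g by (simp add: is_mono_def is_epi_def)
  obtain k where k: "is_hom k ?X X" "\<And>x v. v \<in> spc X x \<Longrightarrow> k x (g x v) = v"
    by (rule isomorphic_inverse[OF X mono epi]) (rule that)
  obtain l where l: "is_hom l Y Q" "\<And>x w. w \<in> spc ?X x \<Longrightarrow> l x w = h x (k x w)"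
    using conjunct2[OF Q[unfolded injective_def], rule_format,
        OF sub_mod[OF Y U] Y inclusion_mono[OF U] hom_comp[OF k(1) h]] by blast
  have "l x (g x v) = h x v" if "v \<in> spc X x" for x v
    using l(2)[of "g x v" x] k(2)[OF that] that by (simp add: im_of_def)
  with l(1) show thesis by (rule that)
qed

text \<open>\<open>N\<close> is a retract of \<open>M\<close> up to an automorphism; for finite-dimensional \<open>N\<close> it
  does not matter whether the composite is required to be epi, mono or an isomorphism.\<close>

definition retract ::
  "('p::{finite,order}, 'k::field, 'v::ab_group_add) rep \<Rightarrow> ('p, 'k, 'w::ab_group_add) rep \<Rightarrow> bool"
  where "retract N M \<longleftrightarrow>
    (\<exists>a b. is_hom a N M \<and> is_hom b M N \<and> is_epi (\<lambda>x v. b x (a x v)) N N)"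

lemma retract_epi:
  assumes "retract N M" obtains b where "is_epi b M N"
proof -
  obtain a b where a: "is_hom a N M" and b: "is_hom b M N" and e: "is_epi (\<lambda>x v. b x (a x v)) N N"
    using assms unfolding retract_def by blast
  have "spc N x \<subseteq> b x ` spc M x" for x
  proof
    fix v assume "v \<in> spc N x"
    then obtain u where "u \<in> spc N x" "v = b x (a x u)" using e by (force simp: is_epi_def)
    then show "v \<in> b x ` spc M x" using hom_closed[OF a] by blast
  qed
  then have "is_epi b M N" using b hom_closed[OF b] by (auto simp: is_epi_def)
  then show thesis by (rule that)
qed

text \<open>By finite dimension the epimorphic composite is also monomorphic, and then so is its
  first factor.\<close>

lemma retract_mono:
  assumes N: "is_mod N" and "retract N M" obtains a where "is_mono a N M"
proof -
  obtain a b where a: "is_hom a N M" and b: "is_hom b M N" and e: "is_epi (\<lambda>x v. b x (a x v)) N N"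
    using assms(2) unfolding retract_def by blast
  then have "inj_on (\<lambda>v. b x (a x v)) (spc N x)" for x
    using epi_endo_iff_mono_endo[OF N] by (simp add: is_mono_def)
  then have "is_mono a N M"
    using a unfolding is_mono_def inj_on_def by metis
  then show thesis by (rule that)
qed

text \<open>Both conclusions come from the same lifts \<open>a0\<close> and \<open>b0\<close>: the
  first compares the covers, the second passes the hypothesis \<open>r\<close> on to the syzygies,
  so that the lemma can be iterated.\<close>

lemma projective_cover_retract:
  fixes N :: "('p::{finite,order}, 'k::field, 'v::ab_group_add) rep"
    and M :: "('p, 'k, 'w::ab_group_add) rep"
  assumes N: "is_mod N" and M: "is_mod M" and r: "retract N M"
    and e: "projective_cover e P N" and e': "projective_cover e' P' M"
  shows "retract P P'"
    and "retract (sub_of P (ker_of e P)) (sub_of P' (ker_of e' P'))"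
proof -
  obtain a b where a: "is_hom a N M" and b: "is_hom b M N" and ba: "is_epi (\<lambda>x v. b x (a x v)) N N"
    using r unfolding retract_def by blast
  have P: "projective P" "is_mod P" "is_epi e P N" "is_hom e P N" "superfluous (ker_of e P) P"
    and P': "projective P'" "is_mod P'" "is_epi e' P' M" "is_hom e' P' M"
    using e e' by (auto simp: projective_cover_def projective_def is_epi_def)
  obtain a0 where a0: "is_hom a0 P P'" "\<And>x v. v \<in> spc P x \<Longrightarrow> e' x (a0 x v) = a x (e x v)"
    using projective_lift[OF P(1) P'(2) M P'(3) hom_comp[OF P(4) a]] by blast
  obtain b0 where b0: "is_hom b0 P' P" "\<And>x v. v \<in> spc P' x \<Longrightarrow> e x (b0 x v) = b x (e' x v)"
    using projective_lift[OF P'(1) P(2) N P(3) hom_comp[OF P'(4) b]] by blast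
  let ?c = "\<lambda>x v. b0 x (a0 x v)"
  have c: "is_hom ?c P P" by (rule hom_comp[OF a0(1) b0(1)])
  have ec: "e x (?c x v) = b x (a x (e x v))" if "v \<in> spc P x" for x v
    using b0(2)[OF hom_closed[OF a0(1) that]] a0(2)[OF that] by simp
  have W: "is_sub (im_of ?c P) P" by (rule im_of_sub[OF P(2,2) c])
  \<comment> \<open>For \<open>v\<close> choose \<open>n\<close> with
    \<open>e x v = b x (a x n)\<close> and \<open>u\<close> above \<open>n\<close>; then
    \<open>v\<close> and \<open>?c x u\<close> have the same image under \<open>e\<close>, so they
    differ by an element of the kernel.\<close>
  have "sub_sum (ker_of e P) (im_of ?c P) x = spc P x" for x
  proof
    show "sub_sum (ker_of e P) (im_of ?c P) x \<subseteq> spc P x"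
      using mod_add_closed[OF P(2)] sub_subset[OF W] by (auto simp: sub_sum_def ker_of_def)
    show "spc P x \<subseteq> sub_sum (ker_of e P) (im_of ?c P) x"
    proof
      fix v assume v: "v \<in> spc P x"
      have "e x v \<in> (\<lambda>v. b x (a x v)) ` spc N x"
        using ba hom_closed[OF P(4) v] by (simp add: is_epi_def)
      then obtain n where n: "n \<in> spc N x" "e x v = b x (a x n)" by blast
      obtain u where u: "u \<in> spc P x" "n = e x u"
        using P(3) n(1) unfolding is_epi_def by blast
      have "v - ?c x u \<in> ker_of e P x"
        using v u n ec[OF u(1)] hom_closed[OF c u(1)] mod_diff_closed[OF P(2) v hom_closed[OF c u(1)]]
        by (simp add: ker_of_def hom_diff[OF P(2,4) v])
      moreover have "?c x u \<in> im_of ?c P x" using u by (simp add: im_of_def)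
      moreover have "v = (v - ?c x u) + ?c x u" by simp
      ultimately show "v \<in> sub_sum (ker_of e P) (im_of ?c P) x" unfolding sub_sum_def by blast
    qed
  qed
  then have "sub_sum (ker_of e P) (im_of ?c P) = spc P" by (rule ext)
  then have "im_of ?c P = spc P" using P(5) W unfolding superfluous_def by blast
  then have im: "?c x ` spc P x = spc P x" for x by (auto dest: fun_cong[of _ _ x] simp: im_of_def)
  have epi: "is_epi ?c P P" unfolding is_epi_def using c im by blast
  then show "retract P P'" unfolding retract_def using a0(1) b0(1) by blast
  have mono: "is_mono ?c P P" using epi_endo_iff_mono_endo[OF P(2)] epi by blast
  have K: "is_sub (ker_of e P) P" and K': "is_sub (ker_of e' P') P'"
    by (rule ker_sub[OF P(2) N P(4)], rule ker_sub[OF P'(2) M P'(4)])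
  have aK: "a0 x v \<in> ker_of e' P' x" if "v \<in> ker_of e P x" for x v
    using that a0(2) hom_closed[OF a0(1)] hom_zero[OF N M a] by (auto simp: ker_of_def)
  have bK: "b0 x v \<in> ker_of e P x" if "v \<in> ker_of e' P' x" for x v
    using that b0(2) hom_closed[OF b0(1)] hom_zero[OF M N b] by (auto simp: ker_of_def)
  have a1: "is_hom a0 (sub_of P (ker_of e P)) (sub_of P' (ker_of e' P'))"
    using aK by (intro hom_corestrict hom_restrict[OF a0(1) K]) auto
  have b1: "is_hom b0 (sub_of P' (ker_of e' P')) (sub_of P (ker_of e P))"
    using bK by (intro hom_corestrict hom_restrict[OF b0(1) K']) auto
  \<comment> \<open>For a general epimorphism surjectivity would not restrict to the kernel, but
    injectivity does; the detour through monomorphisms recovers surjectivity there.\<close>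
  have "is_mono ?c (sub_of P (ker_of e P)) (sub_of P (ker_of e P))"
    unfolding is_mono_def
  proof (intro conjI allI)
    show "is_hom ?c (sub_of P (ker_of e P)) (sub_of P (ker_of e P))" by (rule hom_comp[OF a1 b1])
    show "inj_on (?c x) (spc (sub_of P (ker_of e P)) x)" for x
    proof -
      have "inj_on (?c x) (spc P x)" using mono by (simp add: is_mono_def)
      then show ?thesis by (rule inj_on_subset) (auto simp: ker_of_def)
    qed
  qed
  then have "is_epi ?c (sub_of P (ker_of e P)) (sub_of P (ker_of e P))"
    using epi_endo_iff_mono_endo[OF sub_mod[OF P(2) K]] by blast
  with a1 b1 show "retract (sub_of P (ker_of e P)) (sub_of P' (ker_of e' P'))"
    unfolding retract_def by blast
qed

text \<open>The universal property of the cokernel, with the quotient of \<open>Q\<close> by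
  \<open>ker_of d Q\<close> realised as the image of \<open>d\<close>. \<open>g\<close> chooses
  preimages by \<open>inv_into\<close>; two preimages differ by an element that \<open>f\<close>
  kills, so each law can be checked on a convenient preimage.\<close>

lemma hom_factor_through_image:
  assumes Q: "is_mod Q" and d: "is_hom d Q R" and f: "is_hom f Q R'"
    and ker: "\<And>x v. v \<in> ker_of d Q x \<Longrightarrow> f x v = 0"
  obtains g where "is_hom g (sub_of R (im_of d Q)) R'" "\<And>x v. v \<in> spc Q x \<Longrightarrow> g x (d x v) = f x v"
proof -
  define s where "s x = inv_into (spc Q x) (d x)" for x
  define g where "g x w = f x (s x w)" for x w
  have s: "s x w \<in> spc Q x" "d x (s x w) = w" if "w \<in> im_of d Q x" for x w
    using that inv_into_into[of w "d x" "spc Q x"] f_inv_into_f[of w "d x" "spc Q x"]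
    by (auto simp: s_def im_of_def)
  have gd: "g x (d x v) = f x v" if v: "v \<in> spc Q x" for x v
  proof -
    have dv: "d x v \<in> im_of d Q x" using v by (simp add: im_of_def)
    note s = s[OF dv]
    have "s x (d x v) - v \<in> ker_of d Q x"
      using s v mod_diff_closed[OF Q s(1) v] by (simp add: ker_of_def hom_diff[OF Q d s(1) v])
    then show ?thesis using ker hom_diff[OF Q f s(1) v] by (simp add: g_def)
  qed
  have "is_hom g (sub_of R (im_of d Q)) R'"
  proof (rule homI, unfold sub_of_simps)
    show "g x w \<in> spc R' x" if "w \<in> im_of d Q x" for x w
      using s(1)[OF that] hom_closed[OF f] by (simp add: g_def)
    show "g x (u + w) = g x u + g x w" if "u \<in> im_of d Q x" "w \<in> im_of d Q x" for x u w
      using gd[of "s x u + s x w" x] s[OF that(1)] s[OF that(2)]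
      by (simp add: hom_add[OF d] hom_add[OF f] mod_add_closed[OF Q]) (simp add: g_def)
    show "g x (scal R c w) = scal R' c (g x w)" if "w \<in> im_of d Q x" for x c w
      using gd[of "scal Q c (s x w)" x] s[OF that]
      by (simp add: hom_scal[OF d] hom_scal[OF f] mod_scal_closed[OF Q]) (simp add: g_def)
    show "g y (act R x y w) = act R' x y (g x w)" if "x \<le> y" "w \<in> im_of d Q x" for x y w
      using gd[of "act Q x y (s x w)" y] s[OF that(2)] that(1)
      by (simp add: hom_act[OF d] hom_act[OF f] act_closed[OF Q]) (simp add: g_def)
  qed
  then show thesis using gd by (rule that)
qed

text \<open>The image of any \<open>d\<close> whose kernel is the image of \<open>N\<close> is a
  model of the cosyzygy; \<open>R\<close> provides its ambient space and is the next term when the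
  lemma is applied to a coresolution.\<close>

lemma injective_envelope_retract:
  fixes N :: "('p::{finite,order}, 'k::field, 'v::ab_group_add) rep"
    and M :: "('p, 'k, 'w::ab_group_add) rep"
  assumes N: "is_mod N" and M: "is_mod M" and r: "retract N M"
    and e: "injective_envelope e N Q" and e': "injective_envelope e' M Q'"
    and R: "is_mod R" and d: "is_hom d Q R" and kd: "ker_of d Q = im_of e N"
    and R': "is_mod R'" and d': "is_hom d' Q' R'" and kd': "ker_of d' Q' = im_of e' M"
  shows "retract Q Q'"
    and "retract (sub_of R (im_of d Q)) (sub_of R' (im_of d' Q'))"
proof -
  obtain a b where a: "is_hom a N M" and b: "is_hom b M N" and ba: "is_epi (\<lambda>x v. b x (a x v)) N N"
    using r unfolding retract_def by blast
  have Q: "injective Q" "is_mod Q" "is_mono e N Q" "is_hom e N Q" "essential (im_of e N) Q"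
    and Q': "injective Q'" "is_mod Q'" "is_mono e' M Q'" "is_hom e' M Q'"
    using e e' by (auto simp: injective_envelope_def injective_def is_mono_def)
  obtain a0 where a0: "is_hom a0 Q Q'" "\<And>x v. v \<in> spc N x \<Longrightarrow> a0 x (e x v) = e' x (a x v)"
    using injective_extend[OF Q'(1) N Q(2) Q(3) hom_comp[OF a Q'(4)]] by blast
  obtain b0 where b0: "is_hom b0 Q' Q" "\<And>x v. v \<in> spc M x \<Longrightarrow> b0 x (e' x v) = e x (b x v)"
    using injective_extend[OF Q(1) M Q'(2) Q'(3) hom_comp[OF b Q(4)]] by blast
  let ?c = "\<lambda>x v. b0 x (a0 x v)"
  have c: "is_hom ?c Q Q" by (rule hom_comp[OF a0(1) b0(1)])
  have ce: "?c x (e x v) = e x (b x (a x v))" if "v \<in> spc N x" for x v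
    using b0(2)[OF hom_closed[OF a that]] a0(2)[OF that] by simp
  have inj: "inj_on (e x) (spc N x)" "inj_on (\<lambda>v. b x (a x v)) (spc N x)" for x
    using Q(3) ba epi_endo_iff_mono_endo[OF N] by (auto simp: is_mono_def)
  have K: "is_sub (ker_of ?c Q) Q" by (rule ker_sub[OF Q(2,2) c])
  \<comment> \<open>On the image of \<open>e\<close> the composite acts as \<open>b a\<close>, which
    is injective by finite dimension, so its kernel meets the essential subobject trivially.\<close>
  have "sub_Int (im_of e N) (ker_of ?c Q) x \<subseteq> {0}" for x
  proof
    fix w assume "w \<in> sub_Int (im_of e N) (ker_of ?c Q) x"
    then obtain v where v: "v \<in> spc N x" "w = e x v" "?c x (e x v) = 0"
      by (auto simp: sub_Int_def im_of_def ker_of_def)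
    have "e x (b x (a x v)) = 0" using ce v by simp
    then have "b x (a x v) = 0"
      using inj(1) hom_inj_iff[OF N Q(2,4)] hom_closed[OF hom_comp[OF a b] v(1)] by blast
    then have "v = 0" using inj(2) hom_inj_iff[OF N N hom_comp[OF a b]] v(1) by blast
    then show "w \<in> {0}" using v(2) hom_zero[OF N Q(2,4)] by simp
  qed
  moreover have "0 \<in> sub_Int (im_of e N) (ker_of ?c Q) x" for x
    using sub_zero_mem[OF Q(2) K] sub_zero_mem[OF Q(2) im_of_sub[OF N Q(2,4)]] by (simp add: sub_Int_def)
  ultimately have "sub_Int (im_of e N) (ker_of ?c Q) = sub_zero"
    unfolding sub_zero_def by (intro ext) blast
  then have "ker_of ?c Q = sub_zero" using Q(5) K unfolding essential_def by blast
  then have "is_mono ?c Q Q" by (intro mono_of_trivial_kernel[OF Q(2,2) c]) (simp add: sub_zero_def)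
  then have epi: "is_epi ?c Q Q" using epi_endo_iff_mono_endo[OF Q(2)] by blast
  then show "retract Q Q'" unfolding retract_def using a0(1) b0(1) by blast
  let ?C = "sub_of R (im_of d Q)" and ?C' = "sub_of R' (im_of d' Q')"
  have C: "is_mod ?C" and C': "is_mod ?C'"
    using sub_mod[OF R im_of_sub[OF Q(2) R d]] sub_mod[OF R' im_of_sub[OF Q'(2) R' d']] by auto
  have dC: "is_epi d Q ?C" and dC': "is_epi d' Q' ?C'"
    using epi_onto_image[OF d] epi_onto_image[OF d'] by auto
  then have hd: "is_hom d Q ?C" and hd': "is_hom d' Q' ?C'" by (auto simp: is_epi_def)
  have "d' x (a0 x v) = 0" if v: "v \<in> ker_of d Q x" for x v
  proof -
    obtain n where n: "n \<in> spc N x" "v = e x n" using v kd by (auto simp: im_of_def)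
    then have "a0 x v \<in> ker_of d' Q' x"
      unfolding kd' using a0(2)[OF n(1)] hom_closed[OF a n(1)] by (simp add: im_of_def)
    then show ?thesis by (simp add: ker_of_def)
  qed
  then obtain a1 where a1: "is_hom a1 ?C ?C'" "\<And>x v. v \<in> spc Q x \<Longrightarrow> a1 x (d x v) = d' x (a0 x v)"
    using hom_factor_through_image[OF Q(2) d hom_comp[OF a0(1) hd']] by blast
  have "d x (b0 x v) = 0" if v: "v \<in> ker_of d' Q' x" for x v
  proof -
    obtain n where n: "n \<in> spc M x" "v = e' x n" using v kd' by (auto simp: im_of_def)
    then have "b0 x v \<in> ker_of d Q x"
      unfolding kd using b0(2)[OF n(1)] hom_closed[OF b n(1)] by (simp add: im_of_def)
    then show ?thesis by (simp add: ker_of_def)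
  qed
  then obtain b1 where b1: "is_hom b1 ?C' ?C" "\<And>x v. v \<in> spc Q' x \<Longrightarrow> b1 x (d' x v) = d x (b0 x v)"
    using hom_factor_through_image[OF Q'(2) d' hom_comp[OF b0(1) hd]] by blast
  have bd: "b1 x (a1 x (d x v)) = d x (?c x v)" if "v \<in> spc Q x" for x v
    using a1(2)[OF that] b1(2)[OF hom_closed[OF a0(1) that]] by simp
  \<comment> \<open>Surjectivity, unlike injectivity, passes to quotients directly: any
    \<open>w\<close> is some \<open>d x v\<close>, and \<open>v\<close> is hit by
    \<open>?c\<close>.\<close>
  have "spc ?C x \<subseteq> (\<lambda>v. b1 x (a1 x v)) ` spc ?C x" for x
  proof
    fix w assume "w \<in> spc ?C x"
    then obtain v where v: "v \<in> spc Q x" "w = d x v" by (auto simp: im_of_def)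
    have "v \<in> ?c x ` spc Q x" using epi v(1) by (simp add: is_epi_def)
    then obtain u where u: "u \<in> spc Q x" "v = ?c x u" by blast
    then have "w = b1 x (a1 x (d x u))" using v bd by simp
    then show "w \<in> (\<lambda>v. b1 x (a1 x v)) ` spc ?C x" using u(1) by (auto simp: im_of_def)
  qed
  moreover have h: "is_hom (\<lambda>x v. b1 x (a1 x v)) ?C ?C" by (rule hom_comp[OF a1(1) b1(1)])
  ultimately have "is_epi (\<lambda>x v. b1 x (a1 x v)) ?C ?C"
    using hom_closed[OF h] unfolding is_epi_def by blast
  then show "retract ?C ?C'" unfolding retract_def using a1(1) b1(1) by blast
qed

section \<open>Comparison along whole minimal resolutions\<close>

lemma minimal_projective_resolution_retract:
  assumes N: "is_mod N" and M: "is_mod M" and r: "retract N M"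
    and PN: "minimal_projective_resolution N P d e" and PM: "minimal_projective_resolution M P' d' e'"
  shows "retract (P j) (P' j)"
proof -
  have mod: "is_mod (P j)" "is_mod (P' j)" for j
    using PN PM by (auto simp: minimal_projective_resolution_def projective_resolution_def projective_def)
  have hom: "is_hom (d j) (P (Suc j)) (P j)" "is_hom (d' j) (P' (Suc j)) (P' j)" for j
    using PN PM by (auto simp: minimal_projective_resolution_def projective_resolution_def)
  have cov: "projective_cover e (P 0) N" "projective_cover e' (P' 0) M"
    "projective_cover (d j) (P (Suc j)) (sub_of (P j) (im_of (d j) (P (Suc j))))"
    "projective_cover (d' j) (P' (Suc j)) (sub_of (P' j) (im_of (d' j) (P' (Suc j))))" for j
    using PN PM by (auto simp: minimal_projective_resolution_def)
  have exact: "im_of (d 0) (P (Suc 0)) = ker_of e (P 0)" "im_of (d' 0) (P' (Suc 0)) = ker_of e' (P' 0)"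
    "im_of (d (Suc j)) (P (Suc (Suc j))) = ker_of (d j) (P (Suc j))"
    "im_of (d' (Suc j)) (P' (Suc (Suc j))) = ker_of (d' j) (P' (Suc j))" for j
    using PN PM by (auto simp: minimal_projective_resolution_def projective_resolution_def)
  have mod': "is_mod (sub_of (P j) (im_of (d j) (P (Suc j))))"
    "is_mod (sub_of (P' j) (im_of (d' j) (P' (Suc j))))" for j
    by (intro sub_mod im_of_sub mod hom)+
  \<comment> \<open>The \<open>j\<close>-th statement compares the kernels of the covers in degree
    \<open>j\<close>; by exactness these are the images covered in degree
    \<open>j + 1\<close>.\<close>
  have syz: "retract (sub_of (P j) (im_of (d j) (P (Suc j)))) (sub_of (P' j) (im_of (d' j) (P' (Suc j))))" for j
  proof (induction j)
    case 0
    show ?case unfolding exact by (rule projective_cover_retract(2)[OF N M r cov(1,2)])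
  next
    case (Suc j)
    show ?case unfolding exact by (rule projective_cover_retract(2)[OF mod' Suc cov(3,4)])
  qed
  show ?thesis
  proof (cases j)
    case 0
    then show ?thesis using projective_cover_retract(1)[OF N M r cov(1,2)] by simp
  next
    case (Suc k)
    then show ?thesis using projective_cover_retract(1)[OF mod' syz cov(3,4)] by simp
  qed
qed

lemma minimal_injective_coresolution_retract:
  assumes N: "is_mod N" and M: "is_mod M" and r: "retract N M"
    and QN: "minimal_injective_coresolution N Q d e" and QM: "minimal_injective_coresolution M Q' d' e'"
  shows "retract (Q j) (Q' j)"
proof -
  have mod: "is_mod (Q j)" "is_mod (Q' j)" for j
    using QN QM by (auto simp: minimal_injective_coresolution_def injective_coresolution_def injective_def)
  have hom: "is_hom (d j) (Q j) (Q (Suc j))" "is_hom (d' j) (Q' j) (Q' (Suc j))" for j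
    using QN QM by (auto simp: minimal_injective_coresolution_def injective_coresolution_def)
  let ?C = "\<lambda>j. sub_of (Q (Suc j)) (im_of (d j) (Q j))"
  let ?C' = "\<lambda>j. sub_of (Q' (Suc j)) (im_of (d' j) (Q' j))"
  have env: "injective_envelope e N (Q 0)" "injective_envelope e' M (Q' 0)"
    "injective_envelope (\<lambda>x v. v) (?C j) (Q (Suc j))" "injective_envelope (\<lambda>x v. v) (?C' j) (Q' (Suc j))" for j
    using QN QM by (auto simp: minimal_injective_coresolution_def)
  \<comment> \<open>Kernels are expressed as images of the coaugmentation or of the inclusion of the
    cosyzygy, to match the form of the lemma on envelopes.\<close>
  have exact: "ker_of (d 0) (Q 0) = im_of e N" "ker_of (d' 0) (Q' 0) = im_of e' M"
    "ker_of (d (Suc j)) (Q (Suc j)) = im_of (\<lambda>x v. v) (?C j)"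
    "ker_of (d' (Suc j)) (Q' (Suc j)) = im_of (\<lambda>x v. v) (?C' j)" for j
    using QN QM by (auto simp: minimal_injective_coresolution_def injective_coresolution_def im_of_def)
  have mod': "is_mod (?C j)" "is_mod (?C' j)" for j
    by (intro sub_mod im_of_sub mod hom)+
  have base: "retract (Q 0) (Q' 0)" "retract (?C 0) (?C' 0)"
    by (rule injective_envelope_retract[OF N M r env(1,2) mod(1) hom(1) exact(1) mod(2) hom(2) exact(2)])+
  have step: "retract (Q (Suc j)) (Q' (Suc j))" "retract (?C (Suc j)) (?C' (Suc j))"
    if "retract (?C j) (?C' j)" for j
    by (rule injective_envelope_retract[OF mod' that env(3,4) mod(1) hom(1) exact(3) mod(2) hom(2) exact(4)])+
  have cosyz: "retract (?C j) (?C' j)" for j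
    by (induction j) (use base step in auto)
  show ?thesis using base(1) step(1)[OF cosyz] by (cases j) auto
qed


section \<open>Critical sets\<close>

text \<open>The comparison holds for any pair of minimal resolutions, hence for the two picked by
  \<open>SOME\<close>; the existence lemma guarantees that what is picked is one.\<close>

lemma retract_supp_top_proj_term:
  assumes N: "is_mod N" and M: "is_mod M" and r: "retract N M"
  shows "supp_top (proj_term j N) \<subseteq> supp_top (proj_term j M)"
proof -
  define P where "P = (SOME P. \<exists>d e. minimal_projective_resolution N P d e)"
  define P' where "P' = (SOME P. \<exists>d e. minimal_projective_resolution M P d e)"
  have "\<exists>d e. minimal_projective_resolution N P d e"
    unfolding P_def
    using minimal_projective_resolution_exists[OF N]
    by (intro someI_ex[of "\<lambda>P. \<exists>d e. minimal_projective_resolution N P d e"]) blast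
  moreover have "\<exists>d e. minimal_projective_resolution M P' d e"
    unfolding P'_def
    using minimal_projective_resolution_exists[OF M]
    by (intro someI_ex[of "\<lambda>P. \<exists>d e. minimal_projective_resolution M P d e"]) blast
  ultimately obtain d e d' e' where PN: "minimal_projective_resolution N P d e"
    and PM: "minimal_projective_resolution M P' d' e'" by blast
  have "is_mod (P j)" "is_mod (P' j)"
    using PN PM by (auto simp: minimal_projective_resolution_def projective_resolution_def projective_def)
  moreover obtain b where "is_epi b (P' j) (P j)"
    using retract_epi[OF minimal_projective_resolution_retract[OF N M r PN PM]] by blast
  ultimately have "supp_top (P j) \<subseteq> supp_top (P' j)" by (intro epi_supp_top)
  then show ?thesis by (simp add: proj_term_def P_def P'_def)
qed

lemma retract_supp_soc_inj_term:
  assumes N: "is_mod N" and M: "is_mod M" and r: "retract N M"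
  shows "supp (soc (inj_term j N)) \<subseteq> supp (soc (inj_term j M))"
proof -
  define Q where "Q = (SOME Q. \<exists>d e. minimal_injective_coresolution N Q d e)"
  define Q' where "Q' = (SOME Q. \<exists>d e. minimal_injective_coresolution M Q d e)"
  have "\<exists>d e. minimal_injective_coresolution N Q d e"
    unfolding Q_def
    using minimal_injective_coresolution_exists[OF N]
    by (intro someI_ex[of "\<lambda>Q. \<exists>d e. minimal_injective_coresolution N Q d e"]) blast
  moreover have "\<exists>d e. minimal_injective_coresolution M Q' d e"
    unfolding Q'_def
    using minimal_injective_coresolution_exists[OF M]
    by (intro someI_ex[of "\<lambda>Q. \<exists>d e. minimal_injective_coresolution M Q d e"]) blast
  ultimately obtain d e d' e' where QN: "minimal_injective_coresolution N Q d e"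
    and QM: "minimal_injective_coresolution M Q' d' e'" by blast
  have Q: "is_mod (Q j)" "is_mod (Q' j)"
    using QN QM by (auto simp: minimal_injective_coresolution_def injective_coresolution_def injective_def)
  obtain a where "is_mono a (Q j) (Q' j)"
    using retract_mono[OF Q(1) minimal_injective_coresolution_retract[OF N M r QN QM]] by blast
  then have "supp (soc (Q j)) \<subseteq> supp (soc (Q' j))" by (rule mono_supp_soc[OF Q])
  then show ?thesis by (simp add: inj_term_def Q_def Q'_def)
qed

section \<open>From a direct summand to a retract\<close>

lemma interval_module_mod:
  fixes I :: "'p::{finite,order} set"
  assumes "convex_in I"
  shows "is_mod (interval_module I :: ('p, 'k::field, 'k) rep)"
proof -
  have vs: "vector_space ((*) :: 'k \<Rightarrow> 'k \<Rightarrow> 'k)"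
    by unfold_locales (auto simp: algebra_simps)
  then interpret vector_space "(*) :: 'k \<Rightarrow> 'k \<Rightarrow> 'k" .
  have fin: "\<exists>B. finite B \<and> (if x \<in> I then UNIV else {0}) = span B" for x
  proof (cases "x \<in> I")
    case True
    have "span {1} = (UNIV :: 'k set)" by (auto simp: span_singleton)
    with True show ?thesis by (intro exI[of _ "{1}"]) simp
  qed (auto intro!: exI[of _ "{}"])
  \<comment> \<open>For \<open>x \<le> y \<le> z\<close> with both ends in \<open>I\<close>, the
    composite through \<open>y\<close> must be the identity, which requires \<open>y\<close> to lie
    in \<open>I\<close>.\<close>
  have convex: "y \<in> I" if "x \<le> y" "y \<le> z" "x \<in> I" "z \<in> I" for x y z
    using assms that unfolding convex_in_def by blast
  show ?thesis
    unfolding is_mod_def interval_module_def linear_between_def rep.simps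
  proof (intro conjI allI impI ballI)
    fix x y z :: 'p and v :: 'k
    assume "x \<le> y" "y \<le> z" "v \<in> (if x \<in> I then UNIV else {0})"
    then show "(if y \<in> I \<and> z \<in> I then if x \<in> I \<and> y \<in> I then v else 0 else 0) = (if x \<in> I \<and> z \<in> I then v else 0)"
      using convex[of x y z] by simp
  next
    show "vector_space ((*) :: 'k \<Rightarrow> 'k \<Rightarrow> 'k)" by (rule vs)
    show "\<exists>B. finite B \<and> (if x \<in> I then UNIV else {0}) = span B" for x by (rule fin)
  qed (simp_all split: if_splits)
qed

text \<open>The projection picks the \<open>U\<close>-component in \<open>v = u + w\<close>.
  Components are unique because \<open>U\<close> and \<open>W\<close> meet in zero, so each law
  follows by exhibiting the expected component in \<open>pI\<close>.\<close>

lemma direct_summand_projection: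
  assumes M: "is_mod M" and U: "direct_summand U M"
  obtains p where "is_hom p M (sub_of M U)" "\<And>x u. u \<in> U x \<Longrightarrow> p x u = u"
proof -
  obtain W where Us: "is_sub U M" and W: "is_sub W M" and sum: "sub_sum U W = spc M"
    and int: "sub_Int U W = sub_zero"
    using U unfolding direct_summand_def by blast
  have ex: "\<exists>u\<in>U x. v - u \<in> W x" if v: "v \<in> spc M x" for x v
  proof -
    have "v \<in> sub_sum U W x" using sum v by simp
    then obtain u w where "u \<in> U x" "w \<in> W x" "v = u + w" by (auto simp: sub_sum_def)
    then show ?thesis by (intro bexI[of _ u]) auto
  qed
  have uniq: "u = u'" if "u \<in> U x" "u' \<in> U x" "v - u \<in> W x" "v - u' \<in> W x" for x u u' v
  proof -
    have "u - u' \<in> U x" by (rule sub_diff[OF M Us that(1,2)])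
    moreover have "(v - u') - (v - u) \<in> W x" by (rule sub_diff[OF M W that(4,3)])
    then have "u - u' \<in> W x" by simp
    ultimately have "u - u' \<in> sub_Int U W x" by (simp add: sub_Int_def)
    then show ?thesis using int by (simp add: sub_zero_def)
  qed
  define p where "p x v = (SOME u. u \<in> U x \<and> v - u \<in> W x)" for x v
  have p: "p x v \<in> U x" "v - p x v \<in> W x" if "v \<in> spc M x" for x v
    using someI_ex[of "\<lambda>u. u \<in> U x \<and> v - u \<in> W x"] ex[OF that] by (auto simp: p_def)
  have pI: "p x v = u" if "v \<in> spc M x" "u \<in> U x" "v - u \<in> W x" for x u v
    using uniq[OF p(1)[OF that(1)] that(2) p(2)[OF that(1)] that(3)] .
  interpret vector_space "scal M" using M by (rule mod_vector_space)
  have "is_hom p M (sub_of M U)"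
  proof (rule homI, unfold sub_of_simps)
    show "p x v \<in> U x" if "v \<in> spc M x" for x v using p(1)[OF that] .
    show "p x (u + v) = p x u + p x v" if "u \<in> spc M x" "v \<in> spc M x" for x u v
      using sub_add[OF M W p(2)[OF that(1)] p(2)[OF that(2)]] sub_add[OF M Us p(1)[OF that(1)] p(1)[OF that(2)]]
        mod_add_closed[OF M that]
      by (intro pI) (simp_all add: algebra_simps)
    show "p x (scal M c v) = scal M c (p x v)" if "v \<in> spc M x" for x c v
      using sub_scal[OF M W p(2)[OF that], of c] sub_scal[OF M Us p(1)[OF that]] mod_scal_closed[OF M that]
      by (intro pI) (simp_all add: scale_right_diff_distrib)
    show "p y (act M x y v) = act M x y (p x v)" if xy: "x \<le> y" and v: "v \<in> spc M x" for x y v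
    proof (rule pI)
      show "act M x y v \<in> spc M y" by (rule act_closed[OF M xy v])
      show "act M x y (p x v) \<in> U y" by (rule sub_act[OF Us xy p(1)[OF v]])
      have "act M x y (v - p x v) + act M x y (p x v) = act M x y v"
        using act_add[OF M xy sub_subset[OF W p(2)[OF v]] sub_subset[OF Us p(1)[OF v]]] by simp
      then have "act M x y v - act M x y (p x v) = act M x y (v - p x v)" by (simp add: algebra_simps)
      then show "act M x y v - act M x y (p x v) \<in> W y" using sub_act[OF W xy p(2)[OF v]] by simp
    qed
  qed
  moreover have "p x u = u" if "u \<in> U x" for x u
    using pI[OF sub_subset[OF Us that] that] sub_zero_mem[OF M W] by simp
  ultimately show thesis by (rule that)
qed

text \<open>Embed \<open>N\<close> into \<open>M\<close> along \<open>U\<close> and project back: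
  here the composite is the identity. The weaker demand in \<open>retract\<close> matters once the
  maps are lifted to covers and envelopes.\<close>

lemma direct_summand_retract:
  assumes M: "is_mod M" and N: "is_mod N" and U: "direct_summand U M" and iso: "isomorphic N (sub_of M U)"
  shows "retract N M"
proof -
  have Us: "is_sub U M" using U by (simp add: direct_summand_def)
  obtain f where f: "is_mono f N (sub_of M U)" "is_epi f N (sub_of M U)"
    using iso unfolding isomorphic_def by blast
  obtain g where g: "is_hom g (sub_of M U) N" "\<And>x v. v \<in> spc N x \<Longrightarrow> g x (f x v) = v"
    by (rule isomorphic_inverse[OF N f]) (rule that)
  obtain p where p: "is_hom p M (sub_of M U)" "\<And>x u. u \<in> U x \<Longrightarrow> p x u = u"
    using direct_summand_projection[OF M U] by blast
  have hf: "is_hom f N (sub_of M U)" using f by (simp add: is_mono_def)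
  have f': "is_hom f N M" by (rule hom_extend_codomain[OF hf Us])
  have gp: "is_hom (\<lambda>x v. g x (p x v)) M N" by (rule hom_comp[OF p(1) g(1)])
  have id: "g x (p x (f x v)) = v" if "v \<in> spc N x" for x v
    using p(2) hom_closed[OF hf that] g(2)[OF that] by simp
  have "is_epi (\<lambda>x v. g x (p x (f x v))) N N"
    unfolding is_epi_def using hom_comp[OF f' gp] id by simp
  with f' gp show ?thesis unfolding retract_def by blast
qed

theorem lemma3p46:
  fixes M :: "('p::{finite,order}, 'k::field, 'v::ab_group_add) rep"
    and I :: "'p set"
    and i :: nat
  assumes "is_mod M"
    and "interval I"
    and "\<exists>U. direct_summand U M \<and> isomorphic (interval_module I :: ('p, 'k, 'k) rep) (sub_of M U)"
  shows "I \<in> crt i M"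
proof -
  have N: "is_mod (interval_module I :: ('p, 'k, 'k) rep)"
    using assms(2) by (intro interval_module_mod) (simp add: interval_def)
  have "retract (interval_module I :: ('p, 'k, 'k) rep) M"
    using assms(3) direct_summand_retract[OF assms(1) N] by blast
  then show ?thesis
    using assms(2) retract_supp_top_proj_term[OF N assms(1)] retract_supp_soc_inj_term[OF N assms(1)]
    by (simp add: crt_def)
qed

end
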